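(* Let $B$ satisfy the standing assumptions below and let $\xi_0\in\mathcal{M}$. Let $T_{\xi_0}$ be the supremum of the set of $T>0$ such that the flow equation $\xi_t=\varphi^{t,B(\xi)}_\sharp\xi_0$ has a unique current-valued solution on $[0,T]$, and let $\xi\in C([0,T_{\xi_0});\mathcal{M})$ be the corresponding maximal solution. If $T_{\xi_0}<\infty$, then $\lim_{t\to T_{\xi_0}^-}\|\xi_t\|=+\infty$.
   Context: $\mathcal{M}$ is the dual of $C_b(\mathbb{R}^d;\mathbb{R}^d)$ (bounded continuous vector fields, sup norm $\|\cdot\|_\infty$) with dual norm $|\xi|_{\mathcal{M}}=\sup_{\|\theta\|_\infty\le1}|\xi(\theta)|$. Weak norm: $\|\xi\|=\sup\{\xi(\theta):\|\theta\|_\infty+\mathrm{Lip}(\theta)\le1\}$; $\mathcal{M}_w$ is $\mathcal{M}$ with metric $d(\xi,\xi')=\|\xi-\xi'\|$. Standing assumptions: $B:\mathcal{M}_w\to C_b^2(\mathbb{R}^d,\mathbb{R}^d)$ is continuous and there is $C_B>0$ with, for all $\xi,\xi'$: $\|B(\xi)\|_{C_b^2}\le C_B(\|\xi\|+1)$, $\|B(\xi)-B(\xi')\|_\infty\le C_B\|\xi-\xi'\|$, $\|DB(\xi)-DB(\xi')\|_\infty\le C_B\|\xi-\xi'\|$ ($D$ the spatial derivative). $\varphi^{t,B(\xi)}$ is the flow of $\frac{dx_t}{dt}=B(\xi_t)(x_t)$ with $\varphi^{0,B(\xi)}=\mathrm{id}$. Push-forward: $(\varphi_\sharp\theta)(x)=D\varphi(x)^T\theta(\varphi(x))$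 and $(\varphi_\sharp\xi)(\theta)=\xi(\varphi_\sharp\theta)$. *)

theory Defs
  imports "HOL-Analysis.Analysis"
begin

text \<open>Vector fields on the Euclidean space 'a (playing the role of R^d) that are bounded
  and continuous form the Banach space of bcontfun fields (sup norm).  The space M of currents
  is its (continuous) dual.\<close>

type_synonym 'a current = "('a \<Rightarrow>\<^sub>C 'a) \<Rightarrow>\<^sub>L real"

text \<open>Test fields for the weak norm: bounded continuous fields theta with
  sup-norm(theta) + Lip(theta) at most 1 (Lip(theta) is attained as a Lipschitz constant).\<close>

definition weak_tests :: "('a::euclidean_space \<Rightarrow>\<^sub>C 'a) set" where
  "weak_tests = {\<theta>. \<exists>L. lipschitz_on L UNIV (apply_bcontfun \<theta>) \<and> norm \<theta> + L \<le> 1}"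

definition weak_norm :: "'a::euclidean_space current \<Rightarrow> real" where
  "weak_norm \<xi> = (SUP \<theta>\<in>weak_tests. blinfun_apply \<xi> \<theta>)"

definition standing_assms ::
  "('a::euclidean_space current \<Rightarrow> 'a \<Rightarrow> 'a) \<Rightarrow> ('a current \<Rightarrow> 'a \<Rightarrow> ('a \<Rightarrow>\<^sub>L 'a))
   \<Rightarrow> ('a current \<Rightarrow> 'a \<Rightarrow> ('a \<Rightarrow>\<^sub>L 'a \<Rightarrow>\<^sub>L 'a)) \<Rightarrow> real \<Rightarrow> bool" where
  "standing_assms B DB D2B CB \<longleftrightarrow>
     CB > 0 \<and>
     \<comment> \<open>B(xi) is C^2 with derivatives DB(xi), D2B(xi)\<close>
     (\<forall>\<xi> x. (B \<xi> has_derivative blinfun_apply (DB \<xi> x)) (at x)) \<and>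
     (\<forall>\<xi> x. (DB \<xi> has_derivative blinfun_apply (D2B \<xi> x)) (at x)) \<and>
     (\<forall>\<xi>. continuous_on UNIV (D2B \<xi>)) \<and>
     \<comment> \<open>C^2_b bound\<close>
     (\<forall>\<xi> x. norm (B \<xi> x) \<le> CB * (weak_norm \<xi> + 1) \<and>
             norm (DB \<xi> x) \<le> CB * (weak_norm \<xi> + 1) \<and>
             norm (D2B \<xi> x) \<le> CB * (weak_norm \<xi> + 1)) \<and>
     \<comment> \<open>Lipschitz bounds w.r.t. the weak norm\<close>
     (\<forall>\<xi> \<xi>' x. norm (B \<xi> x - B \<xi>' x) \<le> CB * weak_norm (\<xi> - \<xi>')) \<and>
     (\<forall>\<xi> \<xi>' x. norm (DB \<xi> x - DB \<xi>' x) \<le> CB * weak_norm (\<xi> - \<xi>')) \<and>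
     \<comment> \<open>continuity of B from M_w to C^2_b\<close>
     (\<forall>\<xi> \<epsilon>. \<epsilon> > 0 \<longrightarrow> (\<exists>\<delta>>0. \<forall>\<xi>'. weak_norm (\<xi>' - \<xi>) < \<delta> \<longrightarrow>
        (\<forall>x. norm (B \<xi>' x - B \<xi> x) + norm (DB \<xi>' x - DB \<xi> x)
              + norm (D2B \<xi>' x - D2B \<xi> x) \<le> \<epsilon>)))"

definition is_flow ::
  "('a::euclidean_space current \<Rightarrow> 'a \<Rightarrow> 'a) \<Rightarrow> (real \<Rightarrow> 'a current) \<Rightarrow> real
   \<Rightarrow> (real \<Rightarrow> 'a \<Rightarrow> 'a) \<Rightarrow> bool" where
  "is_flow B \<xi> T \<phi> \<longleftrightarrow>
     (\<forall>x. \<phi> 0 x = x \<and>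
        (\<forall>s\<in>{0..T}. ((\<lambda>r. \<phi> r x) has_vector_derivative B (\<xi> s) (\<phi> s x)) (at s within {0..T})))"

definition push_field ::
  "('a::euclidean_space \<Rightarrow> 'a) \<Rightarrow> ('a \<Rightarrow> ('a \<Rightarrow>\<^sub>L 'a)) \<Rightarrow> ('a \<Rightarrow>\<^sub>C 'a) \<Rightarrow> 'a \<Rightarrow> 'a" where
  "push_field \<phi> D\<phi> \<theta> = (\<lambda>x. adjoint (blinfun_apply (D\<phi> x)) (apply_bcontfun \<theta> (\<phi> x)))"

definition is_solution ::
  "('a::euclidean_space current \<Rightarrow> 'a \<Rightarrow> 'a) \<Rightarrow> 'a current \<Rightarrow> real \<Rightarrow> (real \<Rightarrow> 'a current) \<Rightarrow> bool" where
  "is_solution B \<xi>0 T \<xi> \<longleftrightarrow>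
     (\<forall>t\<in>{0..T}. \<forall>\<epsilon>>0. \<exists>\<delta>>0. \<forall>s\<in>{0..T}. \<bar>s - t\<bar> < \<delta> \<longrightarrow> weak_norm (\<xi> s - \<xi> t) < \<epsilon>) \<and>
     (\<exists>\<phi> D\<phi>. is_flow B \<xi> T \<phi> \<and>
        (\<forall>t\<in>{0..T}. \<forall>x. (\<phi> t has_derivative blinfun_apply (D\<phi> t x)) (at x)) \<and>
        (\<forall>t\<in>{0..T}. \<forall>\<theta>. push_field (\<phi> t) (D\<phi> t) \<theta> \<in> bcontfun \<and>
            blinfun_apply (\<xi> t) \<theta> = blinfun_apply \<xi>0 (Bcontfun (push_field (\<phi> t) (D\<phi> t) \<theta>))))"

definition unique_solution_on ::
  "('a::euclidean_space current \<Rightarrow> 'a \<Rightarrow> 'a) \<Rightarrow> 'a current \<Rightarrow> real \<Rightarrow> bool" where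
  "unique_solution_on B \<xi>0 T \<longleftrightarrow>
     (\<exists>\<xi>. is_solution B \<xi>0 T \<xi>) \<and>
     (\<forall>\<xi> \<xi>'. is_solution B \<xi>0 T \<xi> \<longrightarrow> is_solution B \<xi>0 T \<xi>' \<longrightarrow> (\<forall>t\<in>{0..T}. \<xi> t = \<xi>' t))"

end

theory Submission
  imports Defs
begin

text \<open>
  Track the flow by the pair of its displacement and its Jacobian minus the identity, a point of
  the Banach space of bounded continuous maps. Since the weak norm only sees Lipschitz test fields,
  the pushed-forward current depends on this pair in a locally Lipschitz way, so the flow equation
  is an autonomous ODE with a locally Lipschitz right-hand side. Solutions are therefore unique and
  extend as long as the pair stays bounded, which holds as soon as the weak norm of the current is
  bounded.

  It remains to pass from boundedness along a sequence of times to boundedness near the final time.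
  Pushing forward a Lipschitz test field by the flow between two times costs only a factor that
  tends to 1 for short times, so a current of weak norm at most K keeps weak norm at most 2K + 1
  during a time that depends on K alone.
\<close>

section \<open>Ordinary differential equations in Banach spaces\<close>

text \<open>The current itself is not differentiated in time: for a merely continuous test field,
  its composition with the flow need not be differentiable in t. The state obeys x' = B(x) together
  with the variational equation A' = DB(x) A. Carrying the Jacobian as an independent unknown makes
  the pushed-forward current a function on a whole Banach space; that it is the spatial derivative
  of the position is recovered afterwards from the quadratic Taylor remainder of B.

  Two estimates of the current are in play. The crude one, through the dual norm of
  \<open>\<xi>0\<close>, holds for arbitrary states and yields local existence. Comparing weak norms
  at two times needs more: a Lipschitz constant of the pulled-back test field, hence of the
  Jacobian, and there the bound on the second derivative of B enters.

  Every solution turns out to be unique, so the set defining the maximal time only records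
  existence, and a single solution reaching past that time is already a contradiction.\<close>

instance bcontfun :: (metric_space, banach) banach ..

lemma norm_integral_le_increment:
  fixes g :: "real \<Rightarrow> 'b::banach" and \<rho> :: "real \<Rightarrow> real"
  assumes g: "continuous_on {a..b} g"
    and \<rho>: "\<And>s. s \<in> {a..b} \<Longrightarrow> (\<rho> has_vector_derivative \<rho>' s) (at s within {a..b})"
    and le: "\<And>s. s \<in> {a..b} \<Longrightarrow> norm (g s) \<le> \<rho>' s"
    and t: "t \<in> {a..b}"
  shows "norm (integral {a..t} g) \<le> \<rho> t - \<rho> a"
proof -
  have "(\<rho>' has_integral (\<rho> t - \<rho> a)) {a..t}"
    using t by (intro fundamental_theorem_of_calculus)
      (auto intro: has_vector_derivative_within_subset[OF \<rho>])
  moreover have "g integrable_on {a..t}"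
    using t by (intro integrable_continuous_real continuous_on_subset[OF g]) auto
  ultimately have "norm (integral {a..t} g) \<le> integral {a..t} \<rho>'"
    using t le by (intro integral_norm_bound_integral) (auto simp: has_integral_integrable)
  with \<open>(\<rho>' has_integral _) _\<close> show ?thesis by (simp add: integral_unique)
qed

text \<open>The norm of \<open>g\<close> need not be differentiable, so the argument runs on the
  differentiable majorant |g(a)| + integral of (L |g| + e). The source enters as e (t - a), cruder
  than e (exp(L (t - a)) - 1) / L but valid for L = 0 as well.\<close>

lemma gronwall:
  fixes g :: "real \<Rightarrow> 'b::real_normed_vector"
  assumes g: "\<And>s. s \<in> {a..b} \<Longrightarrow> (g has_vector_derivative g' s) (at s within {a..b})"
    and le: "\<And>s. s \<in> {a..b} \<Longrightarrow> norm (g' s) \<le> L * norm (g s) + e"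
    and L: "0 \<le> L" and e: "0 \<le> e" and t: "t \<in> {a..b}"
  shows "norm (g t) \<le> (norm (g a) + e * (t - a)) * exp (L * (t - a))"
proof (cases "t = a")
  case False
  with t have at: "a < t" by simp
  have gc: "continuous_on {a..b} g"
    using g by (meson has_vector_derivative_continuous continuous_on_eq_continuous_within)
  define k where "k s = L * norm (g s) + e" for s
  have kc: "continuous_on {a..b} k"
    unfolding k_def by (intro continuous_intros gc)
  define I where "I s = norm (g a) + integral {a..s} k" for s
  have I': "(I has_vector_derivative k s) (at s within {a..b})" if "s \<in> {a..b}" for s
    unfolding I_def using integral_has_vector_derivative[OF kc that]
    by (auto intro!: derivative_eq_intros)
  have Ic: "continuous_on {a..b} I"
    using I' by (meson has_vector_derivative_continuous continuous_on_eq_continuous_within)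
  have interior: "(h has_vector_derivative h' s) (at s)"
    if "\<And>s. s \<in> {a..b} \<Longrightarrow> (h has_vector_derivative h' s) (at s within {a..b})" "a < s" "s < b"
    for h :: "real \<Rightarrow> 'c::real_normed_vector" and h' s
    using that at_within_Icc_at[of a s b] by (metis atLeastAtMost_iff less_imp_le)
  have gI: "norm (g s) \<le> I s" if s: "s \<in> {a..b}" for s
  proof (cases "s = a")
    case True then show ?thesis by (simp add: I_def)
  next
    case False
    with s have as: "a < s" "s \<le> b" by auto
    \<comment> \<open>The mean value inequality avoids integrating \<open>g'\<close>, which is not
      assumed continuous.\<close>
    have "norm (g s - g a) \<le> I s - I a"
    proof (rule differentiable_bound_general[OF as(1), of g I g' k])
      show "continuous_on {a..s} g" "continuous_on {a..s} I"
        using as by (auto intro: continuous_on_subset[OF gc] continuous_on_subset[OF Ic])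
      fix x assume x: "a < x" "x < s"
      show "(g has_vector_derivative g' x) (at x)" using interior[of g g', OF g] x as by auto
      show "(I has_vector_derivative k x) (at x)" using interior[of I k, OF I'] x as by auto
      show "norm (g' x) \<le> k x" using le[of x] x as by (simp add: k_def)
    qed
    moreover have "I a = norm (g a)" by (simp add: I_def)
    ultimately show ?thesis using norm_triangle_ineq2[of "g s" "g a"] by linarith
  qed
  \<comment> \<open>Since I' = k \<le> L I + e, the integrating factor makes the derivative of
    \<open>J\<close> at most e exp(-L (s - a)) - e \<le> 0.\<close>
  define J where "J s = I s * exp (- L * (s - a)) - e * (s - a)" for s
  have "J t \<le> J a"
  proof (rule DERIV_nonpos_imp_decreasing_open[of a t J])
    show "a \<le> t" using at by simp
    show "continuous_on {a..t} J"
      unfolding J_def using t by (intro continuous_intros continuous_on_subset[OF Ic]) auto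
    fix x assume x: "a < x" "x < t"
    have dI: "(I has_real_derivative k x) (at x)"
      using interior[of I k, OF I'] x t by (auto simp: has_real_derivative_iff_has_vector_derivative)
    let ?y = "(k x - L * I x) * exp (- L * (x - a)) - e"
    have "(J has_real_derivative ?y) (at x)"
      unfolding J_def by (auto intro!: derivative_eq_intros dI simp: algebra_simps)
    moreover have "k x - L * I x \<le> e"
      using gI[of x] x t L by (simp add: k_def mult_left_mono)
    then have "(k x - L * I x) * exp (- L * (x - a)) \<le> e * exp (- L * (x - a))"
      by (intro mult_right_mono) auto
    moreover have "e * exp (- L * (x - a)) \<le> e"
      using e L x by (simp add: mult_left_le)
    ultimately show "\<exists>y. (J has_real_derivative y) (at x) \<and> y \<le> 0"
      by (intro exI[of _ ?y] conjI) linarith+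
  qed
  then have "I t * exp (- L * (t - a)) \<le> norm (g a) + e * (t - a)"
    by (simp add: J_def I_def)
  then have "I t * exp (- L * (t - a)) * exp (L * (t - a)) \<le> (norm (g a) + e * (t - a)) * exp (L * (t - a))"
    by (intro mult_right_mono) auto
  then have "I t \<le> (norm (g a) + e * (t - a)) * exp (L * (t - a))"
    by (simp add: mult.assoc flip: exp_add)
  with gI[OF t] show ?thesis by linarith
qed simp

text \<open>The tube of radius \<rho> t admits fields that are bounded and Lipschitz only on bounded
  sets: if the field is at most \<rho>' there, the Picard iterates never leave it. Continuity is
  asked along curves because the fields used later depend on time through a path of currents that is
  continuous only in the weak norm.\<close>

lemma picard_lindelof:
  fixes f :: "real \<Rightarrow> 'b::banach \<Rightarrow> 'b" and \<rho> :: "real \<Rightarrow> real"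
  assumes L: "0 < L"
    and \<rho>: "\<And>t. t \<in> {a..b} \<Longrightarrow> (\<rho> has_vector_derivative \<rho>' t) (at t within {a..b})"
    and y0: "norm y0 \<le> \<rho> a"
    and bd: "\<And>t x. t \<in> {a..b} \<Longrightarrow> norm x \<le> \<rho> t \<Longrightarrow> norm (f t x) \<le> \<rho>' t"
    and lip: "\<And>t x y. t \<in> {a..b} \<Longrightarrow> norm x \<le> \<rho> t \<Longrightarrow> norm y \<le> \<rho> t \<Longrightarrow>
                norm (f t x - f t y) \<le> L * norm (x - y)"
    and cont: "\<And>y. continuous_on {a..b} y \<Longrightarrow> (\<And>t. t \<in> {a..b} \<Longrightarrow> norm (y t) \<le> \<rho> t) \<Longrightarrow>
                continuous_on {a..b} (\<lambda>t. f t (y t))"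
    and mono: "\<And>s t. a \<le> s \<Longrightarrow> s \<le> t \<Longrightarrow> t \<le> b \<Longrightarrow> \<rho> s \<le> \<rho> t"
    and ab: "a \<le> b"
  obtains y where "y a = y0" "\<And>t. t \<in> {a..b} \<Longrightarrow> norm (y t) \<le> \<rho> t"
    "\<And>t. t \<in> {a..b} \<Longrightarrow> (y has_vector_derivative f t (y t)) (at t within {a..b})"
proof -
  define Y where "Y n = ((\<lambda>y t. y0 + integral {a..t} (\<lambda>s. f s (y s))) ^^ n) (\<lambda>_. y0)" for n
  have YS: "Y (Suc n) = (\<lambda>t. y0 + integral {a..t} (\<lambda>s. f s (Y n s)))" for n
    by (simp add: Y_def)
  have Y: "continuous_on {a..b} (Y n) \<and> (\<forall>t\<in>{a..b}. norm (Y n t) \<le> \<rho> t)" for n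
  proof (induction n)
    case 0
    show ?case using y0 mono by (fastforce simp: Y_def)
  next
    case (Suc n)
    then have c: "continuous_on {a..b} (\<lambda>s. f s (Y n s))" by (intro cont) auto
    have "norm (Y (Suc n) t) \<le> \<rho> t" if t: "t \<in> {a..b}" for t
    proof -
      have "norm (integral {a..t} (\<lambda>s. f s (Y n s))) \<le> \<rho> t - \<rho> a"
        using Suc by (intro norm_integral_le_increment[OF c \<rho> bd t]) auto
      then show ?thesis using y0 norm_triangle_ineq unfolding YS by smt
    qed
    moreover have "continuous_on {a..b} (Y (Suc n))"
      unfolding YS by (intro continuous_intros indefinite_integral_continuous_1 integrable_continuous_real c)
    ultimately show ?case by blast
  qed
  have fc: "continuous_on {a..b} (\<lambda>s. f s (Y n s))" for n
    using Y[of n] by (intro cont) auto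
  let ?D = "2 * \<rho> b"
  \<comment> \<open>The weight exp(2 L (t - a)) gains a factor 1/2 per iteration, so the interval
    need not be short.\<close>
  have step: "norm (Y (Suc n) t - Y n t) \<le> ?D * (1/2)^n * exp (2 * L * (t - a))" if "t \<in> {a..b}" for n t
    using that
  proof (induction n arbitrary: t)
    case 0
    have "norm (Y (Suc 0) t - Y 0 t) \<le> norm (Y (Suc 0) t) + norm (Y 0 t)" by (rule norm_triangle_ineq4)
    also have "\<dots> \<le> \<rho> t + \<rho> t" using Y 0 by (intro add_mono) blast+
    also have "\<dots> \<le> ?D" using 0 mono by fastforce
    also have "\<dots> \<le> ?D * exp (2 * L * (t - a))"
    proof -
      have "0 \<le> norm (Y 0 b)" by simp
      also have "norm (Y 0 b) \<le> \<rho> b" using Y ab by (meson atLeastAtMost_iff order_refl)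
      finally show ?thesis using L 0 by (simp add: mult_le_cancel_left1)
    qed
    finally show ?case by simp
  next
    case (Suc n)
    let ?\<sigma> = "\<lambda>s. ?D * (1/2)^Suc n * exp (2 * L * (s - a))"
    have c: "continuous_on {a..b} (\<lambda>s. f s (Y (Suc n) s) - f s (Y n s))"
      by (intro continuous_intros fc)
    have "Y (Suc (Suc n)) t - Y (Suc n) t = integral {a..t} (\<lambda>s. f s (Y (Suc n) s)) - integral {a..t} (\<lambda>s. f s (Y n s))"
      by (simp add: YS[of "Suc n"] YS[of n])
    also have "\<dots> = integral {a..t} (\<lambda>s. f s (Y (Suc n) s) - f s (Y n s))"
      using Suc.prems by (intro integral_diff[symmetric] integrable_continuous_real continuous_on_subset[OF fc]) auto
    also have "norm \<dots> \<le> ?\<sigma> t - ?\<sigma> a"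
    proof (rule norm_integral_le_increment[OF c _ _ Suc.prems])
      fix s assume s: "s \<in> {a..b}"
      show "(?\<sigma> has_vector_derivative L * (?D * (1/2)^n * exp (2 * L * (s - a)))) (at s within {a..b})"
        unfolding has_real_derivative_iff_has_vector_derivative[symmetric]
        by (auto intro!: derivative_eq_intros)
      have "norm (f s (Y (Suc n) s) - f s (Y n s)) \<le> L * norm (Y (Suc n) s - Y n s)"
        using Y s by (intro lip) blast+
      also have "\<dots> \<le> L * (?D * (1/2)^n * exp (2 * L * (s - a)))"
        using Suc.IH[OF s] L by (intro mult_left_mono) auto
      finally show "norm (f s (Y (Suc n) s) - f s (Y n s)) \<le> \<dots>" .
    qed
    also have "\<dots> \<le> ?\<sigma> t"
    proof -
      have "0 \<le> norm (Y 0 b)" by simp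
      also have "norm (Y 0 b) \<le> \<rho> b" using Y ab by (meson atLeastAtMost_iff order_refl)
      finally show ?thesis by simp
    qed
    finally show ?case .
  qed
  have \<rho>b: "0 \<le> \<rho> b"
    using Y[of 0] ab by (meson atLeastAtMost_iff order_refl norm_ge_zero order_trans)
  let ?M = "\<lambda>n. ?D * exp (2 * L * (b - a)) * (1/2)^n"
  have "norm (Y (Suc n) t - Y n t) \<le> ?M n" if t: "t \<in> {a..b}" for n t
  proof -
    have "?D * (1/2)^n * exp (2 * L * (t - a)) \<le> ?D * (1/2)^n * exp (2 * L * (b - a))"
      using t L \<rho>b by (intro mult_left_mono) auto
    with step[OF t, of n] show ?thesis by (simp add: mult_ac)
  qed
  moreover have "summable ?M" by (intro summable_mult summable_geometric) simp
  ultimately have "uniform_limit {a..b} (\<lambda>n t. \<Sum>i<n. Y (Suc i) t - Y i t) (\<lambda>t. \<Sum>i. Y (Suc i) t - Y i t) sequentially"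
    by (rule Weierstrass_m_test)
  then have "uniform_limit {a..b} (\<lambda>n t. Y 0 t + (\<Sum>i<n. Y (Suc i) t - Y i t))
      (\<lambda>t. Y 0 t + (\<Sum>i. Y (Suc i) t - Y i t)) sequentially"
    by (intro uniform_limit_intros)
  moreover have "Y 0 t + (\<Sum>i<n. Y (Suc i) t - Y i t) = Y n t" for n t
    using sum_lessThan_telescope[of "\<lambda>i. Y i t" n] by simp
  ultimately obtain l where l: "uniform_limit {a..b} Y l sequentially" by auto
  have lc: "continuous_on {a..b} l"
    using Y by (intro uniform_limit_theorem[OF _ l]) auto
  have lim: "(\<lambda>n. Y n t) \<longlonglongrightarrow> l t" if "t \<in> {a..b}" for t
    using tendsto_uniform_limitI[OF l that] .
  have lb: "norm (l t) \<le> \<rho> t" if "t \<in> {a..b}" for t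
    by (rule Lim_norm_ubound[OF _ lim[OF that]]) (use Y that in auto)
  have flc: "continuous_on {a..b} (\<lambda>t. f t (l t))"
    by (rule cont[OF lc lb])
  have eq: "l t = y0 + integral {a..t} (\<lambda>s. f s (l s))" if t: "t \<in> {a..b}" for t
  proof -
    have "uniform_limit {a..t} (\<lambda>n s. f s (Y n s)) (\<lambda>s. f s (l s)) sequentially"
    proof (rule uniform_limitI)
      fix e :: real assume "e > 0"
      then have "\<forall>\<^sub>F n in sequentially. \<forall>s\<in>{a..b}. dist (Y n s) (l s) < e / L"
        using L by (intro uniform_limitD[OF l]) simp
      then show "\<forall>\<^sub>F n in sequentially. \<forall>s\<in>{a..t}. dist (f s (Y n s)) (f s (l s)) < e"
      proof eventually_elim
        case (elim n)
        show ?case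
        proof
          fix s assume "s \<in> {a..t}"
          with t have s: "s \<in> {a..b}" by auto
          have "dist (f s (Y n s)) (f s (l s)) \<le> L * dist (Y n s) (l s)"
            unfolding dist_norm using Y s lb by (intro lip) auto
          also have "\<dots> < L * (e / L)" using elim s L by (intro mult_strict_left_mono) auto
          finally show "dist (f s (Y n s)) (f s (l s)) < e" using L by simp
        qed
      qed
    qed
    moreover have "continuous_on {a..t} (\<lambda>s. f s (Y n s))" for n
      using t by (intro continuous_on_subset[OF fc]) auto
    ultimately obtain I J where "\<And>n. ((\<lambda>s. f s (Y n s)) has_integral I n) {a..t}"
      and J: "((\<lambda>s. f s (l s)) has_integral J) {a..t}" and IJ: "I \<longlonglongrightarrow> J"
      by (rule uniform_limit_integral) (simp, blast)
    then have "integral {a..t} (\<lambda>s. f s (Y n s)) = I n" for n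
      by (intro integral_unique)
    with IJ integral_unique[OF J]
    have "(\<lambda>n. integral {a..t} (\<lambda>s. f s (Y n s))) \<longlonglongrightarrow> integral {a..t} (\<lambda>s. f s (l s))"
      by simp
    then have "(\<lambda>n. Y (Suc n) t) \<longlonglongrightarrow> y0 + integral {a..t} (\<lambda>s. f s (l s))"
      unfolding YS by (intro tendsto_intros)
    with LIMSEQ_Suc[OF lim[OF t]] show ?thesis by (rule LIMSEQ_unique)
  qed
  show ?thesis
  \<comment> \<open>The witness is the integral expression rather than the limit \<open>l\<close>:
    both agree on the interval, and the former is differentiable by the fundamental theorem of
    calculus.\<close>
  proof (rule that[of "\<lambda>t. y0 + integral {a..t} (\<lambda>s. f s (l s))"])
    fix t assume t: "t \<in> {a..b}"
    show "norm (y0 + integral {a..t} (\<lambda>s. f s (l s))) \<le> \<rho> t"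
      using lb[OF t] eq[OF t] by simp
    show "((\<lambda>t. y0 + integral {a..t} (\<lambda>s. f s (l s))) has_vector_derivative
            f t (y0 + integral {a..t} (\<lambda>s. f s (l s)))) (at t within {a..b})"
      unfolding eq[OF t, symmetric]
      by (rule has_vector_derivative_eq_rhs,
          rule has_vector_derivative_add[OF has_vector_derivative_const integral_has_vector_derivative[OF flc t]]) simp
  qed simp
qed

text \<open>The Lipschitz estimate is asked only between the two given curves, so local Lipschitz
  continuity of the field suffices once both curves are bounded.\<close>

lemma ode_unique:
  fixes p q :: "real \<Rightarrow> 'b::real_normed_vector"
  assumes p: "\<And>t. t \<in> {a..b} \<Longrightarrow> (p has_vector_derivative f t (p t)) (at t within {a..b})"
    and q: "\<And>t. t \<in> {a..b} \<Longrightarrow> (q has_vector_derivative f t (q t)) (at t within {a..b})"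
    and lip: "\<And>t. t \<in> {a..b} \<Longrightarrow> norm (f t (p t) - f t (q t)) \<le> L * norm (p t - q t)"
    and "0 \<le> L" "p a = q a" "t \<in> {a..b}"
  shows "p t = q t"
proof -
  have "norm (p t - q t) \<le> (norm (p a - q a) + 0 * (t - a)) * exp (L * (t - a))"
    using assms
    by (intro gronwall[of a b "\<lambda>t. p t - q t" "\<lambda>t. f t (p t) - f t (q t)"] has_vector_derivative_diff) auto
  then show ?thesis using assms by simp
qed

section \<open>The weak norm\<close>

text \<open>The expansion makes linearity in \<open>A\<close> visible, which the defining property
  of the adjoint does not display.\<close>

lemma adjoint_blinfun_eq:
  fixes A :: "'a::euclidean_space \<Rightarrow>\<^sub>L 'a"
  shows "adjoint (blinfun_apply A) v = (\<Sum>b\<in>Basis. (blinfun_apply A b \<bullet> v) *\<^sub>R b)"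
proof (rule euclidean_eqI)
  fix b :: 'a assume b: "b \<in> Basis"
  have "adjoint (blinfun_apply A) v \<bullet> b = blinfun_apply A b \<bullet> v"
    unfolding inner_commute[of _ b]
    by (intro adjoint_works bounded_linear.linear blinfun.bounded_linear_right)
  with b show "adjoint (blinfun_apply A) v \<bullet> b = (\<Sum>b\<in>Basis. (blinfun_apply A b \<bullet> v) *\<^sub>R b) \<bullet> b"
    by (simp add: inner_sum_left_Basis)
qed

text \<open>Cancel one factor in |A^T v|^2 = <A A^T v, v> \<le> |A| |A^T v| |v|.\<close>

lemma norm_adjoint_blinfun_le:
  fixes A :: "'a::euclidean_space \<Rightarrow>\<^sub>L 'a"
  shows "norm (adjoint (blinfun_apply A) v) \<le> norm A * norm v"
proof -
  let ?w = "adjoint (blinfun_apply A) v"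
  have "norm ?w * norm ?w = blinfun_apply A ?w \<bullet> v"
    using adjoint_works[of "blinfun_apply A" ?w v]
    by (simp add: bounded_linear.linear blinfun.bounded_linear_right flip: power2_eq_square power2_norm_eq_inner)
  also have "\<dots> \<le> norm (blinfun_apply A ?w) * norm v" by (rule norm_cauchy_schwarz)
  also have "\<dots> \<le> (norm A * norm ?w) * norm v"
    by (intro mult_right_mono norm_blinfun) auto
  finally have "norm ?w * norm ?w \<le> (norm A * norm v) * norm ?w" by (simp add: mult_ac)
  then show ?thesis
    by (cases "norm ?w = 0") (auto simp: mult_le_cancel_right)
qed

lemma bounded_bilinear_adjoint_blinfun:
  "bounded_bilinear (\<lambda>(A :: 'a::euclidean_space \<Rightarrow>\<^sub>L 'a) v. adjoint (blinfun_apply A) v)"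
proof
  show "\<exists>K. \<forall>(A :: 'a \<Rightarrow>\<^sub>L 'a) v. norm (adjoint (blinfun_apply A) v) \<le> norm A * norm v * K"
    by (intro exI[of _ 1]) (simp add: norm_adjoint_blinfun_le)
qed (simp_all add: adjoint_blinfun_eq blinfun.add_left blinfun.scaleR_left inner_add_left inner_add_right
      scaleR_add_left sum.distrib scaleR_sum_right)

interpretation adj: bounded_bilinear "\<lambda>(A :: 'a::euclidean_space \<Rightarrow>\<^sub>L 'a) v. adjoint (blinfun_apply A) v"
  by (rule bounded_bilinear_adjoint_blinfun)

lemma adjoint_blinfun_compose:
  fixes A C :: "'a::euclidean_space \<Rightarrow>\<^sub>L 'a"
  shows "adjoint (blinfun_apply (A o\<^sub>L C)) v = adjoint (blinfun_apply C) (adjoint (blinfun_apply A) v)"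
proof -
  have "adjoint (blinfun_apply (A o\<^sub>L C)) = (\<lambda>v. adjoint (blinfun_apply C) (adjoint (blinfun_apply A) v))"
    by (rule adjoint_unique)
      (simp add: adjoint_works bounded_linear.linear blinfun.bounded_linear_right)
  then show ?thesis by simp
qed

section \<open>Test fields, the weak norm, and weak continuity in time\<close>

lemma weak_testsE:
  assumes "\<theta> \<in> weak_tests"
  obtains L where "0 \<le> L" "norm \<theta> + L \<le> 1" "norm \<theta> \<le> 1" "L \<le> 1"
    "\<And>x y. norm (apply_bcontfun \<theta> x - apply_bcontfun \<theta> y) \<le> L * norm (x - y)"
proof -
  obtain L where L: "L-lipschitz_on UNIV (apply_bcontfun \<theta>)" "norm \<theta> + L \<le> 1"
    using assms by (auto simp: weak_tests_def)
  moreover note lipschitz_on_nonneg[OF L(1)] norm_ge_zero[of \<theta>]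
  ultimately show ?thesis
    by (intro that[of L] lipschitz_on_normD[OF L(1)]) (linarith | simp)+
qed

lemma zero_weak_tests: "0 \<in> weak_tests"
  by (auto simp: weak_tests_def lipschitz_on_def intro!: exI[of _ 0])

lemma uminus_weak_tests: "\<theta> \<in> weak_tests \<Longrightarrow> - \<theta> \<in> weak_tests"
  by (auto simp: weak_tests_def lipschitz_on_def dist_minus)

lemma apply_weak_tests_le_norm:
  assumes "\<theta> \<in> weak_tests"
  shows "blinfun_apply \<xi> \<theta> \<le> norm \<xi>"
proof -
  have "blinfun_apply \<xi> \<theta> \<le> norm \<xi> * norm \<theta>" using norm_blinfun[of \<xi> \<theta>] by simp
  also have "\<dots> \<le> norm \<xi> * 1" using assms by (intro mult_left_mono) (auto elim: weak_testsE)
  finally show ?thesis by simp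
qed

lemma apply_le_weak_norm:
  assumes "\<theta> \<in> weak_tests"
  shows "blinfun_apply \<xi> \<theta> \<le> weak_norm \<xi>"
  unfolding weak_norm_def using assms
  by (intro cSUP_upper bdd_aboveI2[where M="norm \<xi>"] apply_weak_tests_le_norm)

lemma weak_norm_leI:
  assumes "\<And>\<theta>. \<theta> \<in> weak_tests \<Longrightarrow> blinfun_apply \<xi> \<theta> \<le> C"
  shows "weak_norm \<xi> \<le> C"
  unfolding weak_norm_def using assms zero_weak_tests by (intro cSUP_least) auto

lemma weak_norm_nonneg: "0 \<le> weak_norm \<xi>"
  using apply_le_weak_norm[OF zero_weak_tests, of \<xi>] by (simp add: blinfun.zero_right)

lemma weak_norm_zero [simp]: "weak_norm 0 = 0"
  by (intro antisym weak_norm_nonneg weak_norm_leI) (simp add: blinfun.zero_left)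

lemma weak_norm_triangle: "weak_norm (\<xi> + \<zeta>) \<le> weak_norm \<xi> + weak_norm \<zeta>"
  by (intro weak_norm_leI) (simp add: blinfun.add_left add_mono apply_le_weak_norm)

lemma weak_norm_minus [simp]: "weak_norm (- \<xi>) = weak_norm \<xi>"
proof -
  have "weak_norm (- \<zeta>) \<le> weak_norm \<zeta>" for \<zeta> :: "'a current"
    by (intro weak_norm_leI)
      (metis apply_le_weak_norm blinfun.minus_left blinfun.minus_right uminus_weak_tests)
  from this[of \<xi>] this[of "- \<xi>"] show ?thesis by simp
qed

lemma weak_norm_diff_commute: "weak_norm (\<xi> - \<zeta>) = weak_norm (\<zeta> - \<xi>)"
  by (metis minus_diff_eq weak_norm_minus)

lemma weak_norm_diff_le: "weak_norm \<xi> \<le> weak_norm \<zeta> + weak_norm (\<xi> - \<zeta>)"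
  using weak_norm_triangle[of \<zeta> "\<xi> - \<zeta>"] by simp

text \<open>Scaling by 1/c moves the field into the test class. Any admissible upper bounds
  \<open>L\<close> and \<open>c\<close> do, so the optimal Lipschitz constant never has to be
  named.\<close>

lemma apply_le_mult_weak_norm:
  assumes lip: "L-lipschitz_on UNIV (apply_bcontfun \<theta>)" and le: "norm \<theta> + L \<le> c" and c: "0 < c"
  shows "blinfun_apply \<xi> \<theta> \<le> c * weak_norm \<xi>"
proof -
  have "(L / c)-lipschitz_on UNIV (apply_bcontfun ((1 / c) *\<^sub>R \<theta>))"
    using lip c by (auto simp: lipschitz_on_def dist_norm divide_right_mono simp flip: scaleR_diff_right)
  moreover have "norm ((1 / c) *\<^sub>R \<theta>) + L / c \<le> 1"
    using le c by (simp add: field_simps)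
  ultimately have "(1 / c) *\<^sub>R \<theta> \<in> weak_tests" by (auto simp: weak_tests_def)
  from apply_le_weak_norm[OF this, of \<xi>] c show ?thesis by (simp add: blinfun.scaleR_right field_simps)
qed

text \<open>Continuity into the space of currents with the weak metric. It is phrased through real
  limits, since \<open>continuous_on\<close> at this type would refer to the dual norm.\<close>

definition weakly_continuous_on :: "real set \<Rightarrow> (real \<Rightarrow> 'a::euclidean_space current) \<Rightarrow> bool" where
  "weakly_continuous_on S \<xi> \<longleftrightarrow>
     (\<forall>t\<in>S. ((\<lambda>s. weak_norm (\<xi> s - \<xi> t)) \<longlongrightarrow> 0) (at t within S))"

lemma weakly_continuous_on_iff:
  "weakly_continuous_on S \<xi> \<longleftrightarrow>
     (\<forall>t\<in>S. \<forall>\<epsilon>>0. \<exists>\<delta>>0. \<forall>s\<in>S. \<bar>s - t\<bar> < \<delta> \<longrightarrow> weak_norm (\<xi> s - \<xi> t) < \<epsilon>)"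
proof -
  \<comment> \<open>Limits ignore s = t while the epsilon-delta form includes it; the two agree
    because the weak norm of 0 is 0.\<close>
  have key: "(0 < dist s t \<and> dist s t < \<delta> \<longrightarrow> dist (weak_norm (\<xi> s - \<xi> t)) 0 < \<epsilon>) \<longleftrightarrow>
        (\<bar>s - t\<bar> < \<delta> \<longrightarrow> weak_norm (\<xi> s - \<xi> t) < \<epsilon>)"
    if "0 < \<epsilon>" for s t \<epsilon> \<delta>
    using that by (cases "s = t") (simp_all add: dist_real_def weak_norm_nonneg)
  show ?thesis
    unfolding weakly_continuous_on_def Lim_within by (simp only: key cong: imp_cong)
qed

lemma weakly_continuous_on_subset:
  "weakly_continuous_on S \<xi> \<Longrightarrow> T \<subseteq> S \<Longrightarrow> weakly_continuous_on T \<xi>"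
  unfolding weakly_continuous_on_def by (meson tendsto_within_subset subsetD)

lemma continuous_on_weak_norm:
  assumes "weakly_continuous_on S \<xi>"
  shows "continuous_on S (\<lambda>t. weak_norm (\<xi> t))"
  unfolding continuous_on_def
proof
  fix t assume "t \<in> S"
  have "((\<lambda>s. weak_norm (\<xi> s) - weak_norm (\<xi> t)) \<longlongrightarrow> 0) (at t within S)"
  proof (rule Lim_null_comparison)
    show "((\<lambda>s. weak_norm (\<xi> s - \<xi> t)) \<longlongrightarrow> 0) (at t within S)"
      using assms \<open>t \<in> S\<close> by (auto simp: weakly_continuous_on_def)
    show "\<forall>\<^sub>F s in at t within S. norm (weak_norm (\<xi> s) - weak_norm (\<xi> t)) \<le> weak_norm (\<xi> s - \<xi> t)"
      using weak_norm_diff_le[of "\<xi> s" "\<xi> t" for s] weak_norm_diff_le[of "\<xi> t" "\<xi> s" for s]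
      by (intro always_eventually) (auto simp: abs_le_iff weak_norm_diff_commute algebra_simps)
  qed
  then show "((\<lambda>s. weak_norm (\<xi> s)) \<longlongrightarrow> weak_norm (\<xi> t)) (at t within S)"
    by (rule LIM_zero_cancel)
qed

lemma weakly_continuous_on_bounded:
  assumes "weakly_continuous_on {a..b} \<xi>"
  obtains K where "0 \<le> K" "\<And>t. t \<in> {a..b} \<Longrightarrow> weak_norm (\<xi> t) \<le> K"
proof -
  have "compact ((\<lambda>t. weak_norm (\<xi> t)) ` {a..b})"
    by (intro compact_continuous_image continuous_on_weak_norm assms) auto
  then obtain K where "\<forall>x\<in>(\<lambda>t. weak_norm (\<xi> t)) ` {a..b}. norm x \<le> K"
    using compact_imp_bounded bounded_iff by blast
  then show ?thesis by (intro that[of "max 0 K"]) (auto simp: abs_le_iff intro: max.coboundedI2)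
qed

section \<open>Flow states and pushed-forward currents\<close>

text \<open>A state stores the displacement \<open>\<phi> - id\<close> and \<open>D\<phi> - I\<close>: unlike \<open>\<phi>\<close> itself, these are bounded.\<close>

type_synonym 'a flow_state = "'a \<Rightarrow>\<^sub>C ('a \<times> ('a \<Rightarrow>\<^sub>L 'a))"

definition flow_pos :: "'a::euclidean_space flow_state \<Rightarrow> 'a \<Rightarrow> 'a" where
  "flow_pos y x = x + fst (apply_bcontfun y x)"

definition flow_jac :: "'a::euclidean_space flow_state \<Rightarrow> 'a \<Rightarrow> ('a \<Rightarrow>\<^sub>L 'a)" where
  "flow_jac y x = id_blinfun + snd (apply_bcontfun y x)"

lemma flow_pos_zero [simp]: "flow_pos 0 x = x"
  by (simp add: flow_pos_def)

lemma flow_jac_zero [simp]: "flow_jac 0 x = id_blinfun"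
  by (simp add: flow_jac_def)

lemma norm_pos_diff_le: "norm (flow_pos y x - flow_pos y' x) \<le> norm (y - y')"
proof -
  have "flow_pos y x - flow_pos y' x = fst (apply_bcontfun (y - y') x)"
    by (simp add: flow_pos_def)
  then show ?thesis
    using norm_bounded[of "y - y'" x]
    by (metis norm_fst_le order_trans prod.collapse)
qed

lemma norm_jac_diff_le: "norm (flow_jac y x - flow_jac y' x) \<le> norm (y - y')"
proof -
  have "flow_jac y x - flow_jac y' x = snd (apply_bcontfun (y - y') x)"
    by (simp add: flow_jac_def)
  then show ?thesis
    using norm_bounded[of "y - y'" x]
    by (metis norm_snd_le order_trans prod.collapse)
qed

lemma norm_jac_le: "norm (flow_jac y x) \<le> 1 + norm y"
  using norm_jac_diff_le[of y x 0] norm_triangle_sub[of "flow_jac y x" id_blinfun]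
    norm_blinfun_id_le[where 'a='a] by (simp add: norm_minus_commute)

lemma continuous_on_pos [continuous_intros]: "continuous_on S (flow_pos y)"
  unfolding flow_pos_def by (intro continuous_intros continuous_on_apply_bcontfun)

lemma continuous_on_jac [continuous_intros]: "continuous_on S (flow_jac y)"
  unfolding flow_jac_def by (intro continuous_intros continuous_on_apply_bcontfun)

lemma push_field_bcontfun: "push_field (flow_pos y) (flow_jac y) \<theta> \<in> bcontfun"
proof (rule bcontfun_normI)
  show "continuous_on UNIV (push_field (flow_pos y) (flow_jac y) \<theta>)"
    unfolding push_field_def
    by (intro adj.continuous_on continuous_intros
        continuous_on_compose2[OF continuous_on_apply_bcontfun[of UNIV]]) auto
  show "norm (push_field (flow_pos y) (flow_jac y) \<theta> x) \<le> (1 + norm y) * norm \<theta>" for x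
    unfolding push_field_def
    by (rule order_trans[OF norm_adjoint_blinfun_le])
      (intro mult_mono norm_jac_le norm_bounded, auto)
qed

text \<open>Fields are transported against the flow, hence the name. The result is a bounded
  continuous field for every state, even if \<open>flow_jac y\<close> is not the derivative of
  \<open>flow_pos y\<close>; this is what extends the push-forward of currents to the whole state
  space.\<close>

definition pull_field :: "'a::euclidean_space flow_state \<Rightarrow> ('a \<Rightarrow>\<^sub>C 'a) \<Rightarrow> 'a \<Rightarrow>\<^sub>C 'a" where
  "pull_field y \<theta> = Bcontfun (push_field (flow_pos y) (flow_jac y) \<theta>)"

lemma apply_pull_field:
  "apply_bcontfun (pull_field y \<theta>) x =
    adjoint (blinfun_apply (flow_jac y x)) (apply_bcontfun \<theta> (flow_pos y x))"
  unfolding pull_field_def by (simp add: Bcontfun_inverse push_field_bcontfun) (simp add: push_field_def)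

lemma norm_pull_field_le: "norm (pull_field y \<theta>) \<le> (1 + norm y) * norm \<theta>"
  unfolding apply_pull_field
  by (rule norm_bound, unfold apply_pull_field, rule order_trans[OF norm_adjoint_blinfun_le])
      (intro mult_mono norm_jac_le norm_bounded, auto)

lemma bounded_linear_pull_field: "bounded_linear (pull_field y)"
proof (rule bounded_linear_intro)
  show "norm (pull_field y \<theta>) \<le> norm \<theta> * (1 + norm y)" for \<theta>
    using norm_pull_field_le[of y \<theta>] by (simp add: mult.commute)
qed (auto intro!: bcontfun_eqI simp: apply_pull_field adj.add_right adj.scaleR_right)

definition push_current :: "'a::euclidean_space current \<Rightarrow> 'a flow_state \<Rightarrow> 'a current" where
  "push_current \<xi>0 y = Blinfun (\<lambda>\<theta>. blinfun_apply \<xi>0 (pull_field y \<theta>))"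

lemma apply_push_current:
  "blinfun_apply (push_current \<xi>0 y) \<theta> = blinfun_apply \<xi>0 (pull_field y \<theta>)"
  unfolding push_current_def
  by (subst bounded_linear_Blinfun_apply)
    (auto intro: bounded_linear_compose[OF blinfun.bounded_linear_right bounded_linear_pull_field])

lemma blinfun_apply_le_norm:
  fixes f :: "'b::real_normed_vector \<Rightarrow>\<^sub>L real"
  shows "blinfun_apply f x \<le> norm f * norm x"
  using norm_blinfun[of f x] by simp

text \<open>Moving the position costs Lip(\<theta>) times the size 1 + |y| of the Jacobian, moving
  the Jacobian costs sup |\<theta>|; both test quantities are at most 1, which gives 2 +
  |y|.\<close>

lemma norm_pull_field_diff_le:
  assumes "\<theta> \<in> weak_tests"
  shows "norm (pull_field y \<theta> - pull_field y' \<theta>) \<le> (2 + norm y) * norm (y - y')"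
proof (rule norm_bound)
  fix x
  obtain L where L: "0 \<le> L" "norm \<theta> \<le> 1" "L \<le> 1"
    "\<And>x y. norm (apply_bcontfun \<theta> x - apply_bcontfun \<theta> y) \<le> L * norm (x - y)"
    using assms by (elim weak_testsE) blast
  let ?t = "apply_bcontfun \<theta>" and ?J = "flow_jac y x" and ?J' = "flow_jac y' x"
  let ?p = "flow_pos y x" and ?p' = "flow_pos y' x"
  have "apply_bcontfun (pull_field y \<theta> - pull_field y' \<theta>) x =
      adjoint (blinfun_apply ?J) (?t ?p - ?t ?p') + adjoint (blinfun_apply (?J - ?J')) (?t ?p')"
    by (simp only: minus_bcontfun.rep_eq apply_pull_field adj.diff_left adj.diff_right) simp
  also have "norm \<dots> \<le> norm ?J * norm (?t ?p - ?t ?p') + norm (?J - ?J') * norm (?t ?p')"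
    by (intro norm_triangle_le add_mono norm_adjoint_blinfun_le)
  also have "\<dots> \<le> (1 + norm y) * norm (y - y') + norm (y - y') * 1"
  proof (intro add_mono mult_mono norm_jac_le norm_jac_diff_le)
    have "norm (?t ?p - ?t ?p') \<le> L * norm (?p - ?p')" by (rule L)
    also have "\<dots> \<le> 1 * norm (y - y')"
      using L by (intro mult_mono norm_pos_diff_le) auto
    finally show "norm (?t ?p - ?t ?p') \<le> norm (y - y')" by simp
    show "norm (?t ?p') \<le> 1" using norm_bounded[of \<theta> ?p'] L by linarith
  qed auto
  finally show "norm (apply_bcontfun (pull_field y \<theta> - pull_field y' \<theta>) x) \<le> (2 + norm y) * norm (y - y')"
    by (simp add: algebra_simps)
qed

text \<open>The dual norm of \<open>\<xi>0\<close> appears because the two pulled-back fields are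
  close only in the sup norm: the Jacobian part of an arbitrary state need not be Lipschitz in
  space.\<close>

lemma weak_norm_push_current_diff_le:
  "weak_norm (push_current \<xi>0 y - push_current \<xi>0 y') \<le> norm \<xi>0 * ((2 + norm y) * norm (y - y'))"
proof (rule weak_norm_leI)
  fix \<theta> :: "'a \<Rightarrow>\<^sub>C 'a" assume \<theta>: "\<theta> \<in> weak_tests"
  have "blinfun_apply (push_current \<xi>0 y - push_current \<xi>0 y') \<theta>
      = blinfun_apply \<xi>0 (pull_field y \<theta> - pull_field y' \<theta>)"
    by (simp add: blinfun.diff_left blinfun.diff_right apply_push_current)
  also have "\<dots> \<le> norm \<xi>0 * norm (pull_field y \<theta> - pull_field y' \<theta>)"
    by (rule blinfun_apply_le_norm)
  also have "\<dots> \<le> norm \<xi>0 * ((2 + norm y) * norm (y - y'))"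
    by (intro mult_left_mono norm_pull_field_diff_le \<theta>) simp
  finally show "blinfun_apply (push_current \<xi>0 y - push_current \<xi>0 y') \<theta> \<le> \<dots>" .
qed

lemma weak_norm_push_current_le: "weak_norm (push_current \<xi>0 y) \<le> norm \<xi>0 * (1 + norm y)"
proof (rule weak_norm_leI)
  fix \<theta> :: "'a \<Rightarrow>\<^sub>C 'a" assume "\<theta> \<in> weak_tests"
  then have \<theta>: "norm \<theta> \<le> 1" by (elim weak_testsE)
  have "blinfun_apply (push_current \<xi>0 y) \<theta> \<le> norm \<xi>0 * norm (pull_field y \<theta>)"
    unfolding apply_push_current by (rule blinfun_apply_le_norm)
  also have "norm (pull_field y \<theta>) \<le> (1 + norm y) * 1"
    by (rule order_trans[OF norm_pull_field_le]) (use \<theta> in \<open>intro mult_left_mono; simp\<close>)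
  finally show "blinfun_apply (push_current \<xi>0 y) \<theta> \<le> norm \<xi>0 * (1 + norm y)"
    by (simp add: mult_left_mono)
qed

lemma weakly_continuous_on_push_current:
  assumes "continuous_on S y"
  shows "weakly_continuous_on S (\<lambda>t. push_current \<xi>0 (y t))"
  unfolding weakly_continuous_on_def
proof
  fix t assume t: "t \<in> S"
  show "((\<lambda>s. weak_norm (push_current \<xi>0 (y s) - push_current \<xi>0 (y t))) \<longlongrightarrow> 0) (at t within S)"
  proof (rule Lim_null_comparison)
    show "\<forall>\<^sub>F s in at t within S. norm (weak_norm (push_current \<xi>0 (y s) - push_current \<xi>0 (y t)))
        \<le> norm \<xi>0 * ((2 + norm (y t)) * norm (y t - y s))"
      using weak_norm_push_current_diff_le[of \<xi>0 "y t"]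
      by (intro always_eventually) (simp add: weak_norm_nonneg weak_norm_diff_commute[of _ "push_current \<xi>0 (y t)"])
    have "(y \<longlongrightarrow> y t) (at t within S)" using assms t by (auto simp: continuous_on_def)
    then have "((\<lambda>s. norm \<xi>0 * ((2 + norm (y t)) * norm (y t - y s))) \<longlongrightarrow>
        norm \<xi>0 * ((2 + norm (y t)) * norm (y t - y t))) (at t within S)"
      by (intro tendsto_intros)
    then show "((\<lambda>s. norm \<xi>0 * ((2 + norm (y t)) * norm (y t - y s))) \<longlongrightarrow> 0) (at t within S)" by simp
  qed
qed

section \<open>The flow equation as an ODE\<close>

locale current_transport =
  fixes B :: "'a::euclidean_space current \<Rightarrow> 'a \<Rightarrow> 'a"
    and DB :: "'a current \<Rightarrow> 'a \<Rightarrow> ('a \<Rightarrow>\<^sub>L 'a)"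
    and D2B :: "'a current \<Rightarrow> 'a \<Rightarrow> ('a \<Rightarrow>\<^sub>L 'a \<Rightarrow>\<^sub>L 'a)"
    and CB :: real
  assumes standing: "standing_assms B DB D2B CB"
begin

section \<open>Consequences of the standing assumptions\<close>

lemma CB_pos: "0 < CB"
  using standing by (simp add: standing_assms_def)

lemma B_has_derivative: "(B \<xi> has_derivative blinfun_apply (DB \<xi> x)) (at x within S)"
  using standing by (auto simp: standing_assms_def intro: has_derivative_at_withinI)

lemma DB_has_derivative: "(DB \<xi> has_derivative blinfun_apply (D2B \<xi> x)) (at x within S)"
  using standing by (auto simp: standing_assms_def intro: has_derivative_at_withinI)

lemma B_bound: "norm (B \<xi> x) \<le> CB * (weak_norm \<xi> + 1)"
  and DB_bound: "norm (DB \<xi> x) \<le> CB * (weak_norm \<xi> + 1)"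
  and D2B_bound: "norm (D2B \<xi> x) \<le> CB * (weak_norm \<xi> + 1)"
  using standing by (auto simp: standing_assms_def)

lemma B_diff_le: "norm (B \<xi> x - B \<xi>' x) \<le> CB * weak_norm (\<xi> - \<xi>')"
  and DB_diff_le: "norm (DB \<xi> x - DB \<xi>' x) \<le> CB * weak_norm (\<xi> - \<xi>')"
  using standing by (auto simp: standing_assms_def)

lemma B_lipschitz: "norm (B \<xi> x - B \<xi> y) \<le> CB * (weak_norm \<xi> + 1) * norm (x - y)"
  by (rule differentiable_bound[of UNIV _ "\<lambda>x. blinfun_apply (DB \<xi> x)"])
    (auto intro: B_has_derivative DB_bound simp flip: norm_blinfun.rep_eq)

lemma DB_lipschitz: "norm (DB \<xi> x - DB \<xi> y) \<le> CB * (weak_norm \<xi> + 1) * norm (x - y)"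
  by (rule differentiable_bound[of UNIV _ "\<lambda>x. blinfun_apply (D2B \<xi> x)"])
    (auto intro: DB_has_derivative D2B_bound simp flip: norm_blinfun.rep_eq)

text \<open>On the ball of radius |q - p| around p, \<open>DB\<close> varies by at most its
  Lipschitz constant times |q - p|. This quadratic remainder drives the proof that the Jacobian
  component is a derivative.\<close>

lemma B_linearization:
  "norm (B \<xi> q - B \<xi> p - blinfun_apply (DB \<xi> p) (q - p)) \<le> CB * (weak_norm \<xi> + 1) * (norm (q - p))\<^sup>2"
proof -
  let ?S = "cball p (norm (q - p))"
  have "norm (B \<xi> q - B \<xi> p - blinfun_apply (DB \<xi> p) (q - p)) \<le>
      norm (q - p) * (CB * (weak_norm \<xi> + 1) * norm (q - p))"
  proof (rule differentiable_bound_linearization[where S = ?S and f' = "\<lambda>x. blinfun_apply (DB \<xi> x)"])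
    show "p + t *\<^sub>R (q - p) \<in> ?S" if "t \<in> {0..1}" for t
      using that by (auto simp: dist_norm mult_left_le_one_le)
    fix x assume x: "x \<in> ?S"
    have "onorm (blinfun_apply (DB \<xi> x - DB \<xi> p)) \<le> CB * (weak_norm \<xi> + 1) * norm (x - p)"
      using DB_lipschitz[of \<xi> x p] by (simp add: norm_blinfun.rep_eq)
    also have "\<dots> \<le> CB * (weak_norm \<xi> + 1) * norm (q - p)"
      using x CB_pos weak_norm_nonneg[of \<xi>] by (intro mult_left_mono) (auto simp: dist_norm norm_minus_commute)
    finally show "onorm (blinfun_apply (DB \<xi> x) - blinfun_apply (DB \<xi> p)) \<le> CB * (weak_norm \<xi> + 1) * norm (q - p)"
      by (simp add: minus_blinfun.rep_eq fun_diff_def)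
  qed (auto intro: B_has_derivative)
  then show ?thesis by (simp add: power2_eq_square mult_ac)
qed

lemma continuous_on_B: "continuous_on S (B \<xi>)"
  by (rule has_derivative_continuous_on[OF B_has_derivative])

lemma continuous_on_DB: "continuous_on S (DB \<xi>)"
  by (rule has_derivative_continuous_on[OF DB_has_derivative])

text \<open>The second component is the variational equation; the identities added back by
  \<open>flow_pos\<close> and \<open>flow_jac\<close> are constant in time. The current is a
  separate argument, so the same field serves a prescribed path of currents and the self-consistent
  problem.\<close>

definition flow_field :: "'a current \<Rightarrow> 'a flow_state \<Rightarrow> 'a flow_state" where
  "flow_field \<zeta> y = Bcontfun (\<lambda>x. (B \<zeta> (flow_pos y x), DB \<zeta> (flow_pos y x) o\<^sub>L flow_jac y x))"

lemma norm_flow_field_apply_le: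
  "norm (B \<zeta> (flow_pos y x), DB \<zeta> (flow_pos y x) o\<^sub>L flow_jac y x) \<le> CB * (weak_norm \<zeta> + 1) * (2 + norm y)"
proof -
  have "norm (B \<zeta> (flow_pos y x), DB \<zeta> (flow_pos y x) o\<^sub>L flow_jac y x)
      \<le> norm (B \<zeta> (flow_pos y x)) + norm (DB \<zeta> (flow_pos y x)) * norm (flow_jac y x)"
    by (rule order_trans[OF norm_Pair_le add_left_mono[OF norm_blinfun_compose]])
  also have "\<dots> \<le> CB * (weak_norm \<zeta> + 1) + CB * (weak_norm \<zeta> + 1) * (1 + norm y)"
    using CB_pos weak_norm_nonneg[of \<zeta>]
    by (intro add_mono mult_mono B_bound DB_bound norm_jac_le) auto
  finally show ?thesis by (simp add: algebra_simps)
qed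

lemma apply_flow_field:
  "apply_bcontfun (flow_field \<zeta> y) x = (B \<zeta> (flow_pos y x), DB \<zeta> (flow_pos y x) o\<^sub>L flow_jac y x)"
proof -
  have "(\<lambda>x. (B \<zeta> (flow_pos y x), DB \<zeta> (flow_pos y x) o\<^sub>L flow_jac y x)) \<in> bcontfun"
  proof (rule bcontfun_normI[OF _ norm_flow_field_apply_le])
    have "continuous_on UNIV (\<lambda>x. B \<zeta> (flow_pos y x))"
      by (rule continuous_on_compose2[OF continuous_on_B[of UNIV] continuous_on_pos]) simp
    moreover have "continuous_on UNIV (\<lambda>x. DB \<zeta> (flow_pos y x))"
      by (rule continuous_on_compose2[OF continuous_on_DB[of UNIV] continuous_on_pos]) simp
    ultimately show "continuous_on UNIV (\<lambda>x. (B \<zeta> (flow_pos y x), DB \<zeta> (flow_pos y x) o\<^sub>L flow_jac y x))"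
      by (intro continuous_on_Pair bounded_bilinear.continuous_on[OF bounded_bilinear_blinfun_compose] continuous_on_jac)
  qed
  then show ?thesis by (simp add: flow_field_def Bcontfun_inverse)
qed

lemma norm_flow_field_le: "norm (flow_field \<zeta> y) \<le> CB * (weak_norm \<zeta> + 1) * (2 + norm y)"
  by (rule norm_bound) (simp only: apply_flow_field norm_flow_field_apply_le)

text \<open>The factor 3 + |y'| collects 1 from B, 1 from the change of Jacobian and 1 + |y'| from
  the change of DB acting on the Jacobian of y'. Changing the current affects B and DB only, whence
  2 + |y'|.\<close>

lemma norm_flow_field_diff_le:
  "norm (flow_field \<zeta> y - flow_field \<zeta>' y') \<le>
    CB * (weak_norm \<zeta> + 1) * (3 + norm y') * norm (y - y') + CB * (2 + norm y') * weak_norm (\<zeta> - \<zeta>')"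
proof (rule norm_bound)
  fix x
  let ?p = "flow_pos y x" and ?p' = "flow_pos y' x" and ?J = "flow_jac y x" and ?J' = "flow_jac y' x"
  let ?L = "CB * (weak_norm \<zeta> + 1)" and ?w = "weak_norm (\<zeta> - \<zeta>')" and ?d = "norm (y - y')"
  have L: "0 \<le> ?L" using CB_pos weak_norm_nonneg[of \<zeta>] by simp
  have 1: "norm (B \<zeta> ?p - B \<zeta>' ?p') \<le> ?L * ?d + CB * ?w"
  proof -
    have "norm (B \<zeta> ?p - B \<zeta>' ?p') \<le> norm (B \<zeta> ?p - B \<zeta> ?p') + norm (B \<zeta> ?p' - B \<zeta>' ?p')"
      using norm_triangle_ineq[of "B \<zeta> ?p - B \<zeta> ?p'" "B \<zeta> ?p' - B \<zeta>' ?p'"] by simp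
    also have "norm (B \<zeta> ?p - B \<zeta> ?p') \<le> ?L * ?d"
      by (rule order_trans[OF B_lipschitz mult_left_mono[OF norm_pos_diff_le L]])
    finally show ?thesis using B_diff_le[of \<zeta> ?p' \<zeta>'] by linarith
  qed
  have 2: "norm (DB \<zeta> ?p - DB \<zeta>' ?p') \<le> ?L * ?d + CB * ?w"
  proof -
    have "norm (DB \<zeta> ?p - DB \<zeta>' ?p') \<le> norm (DB \<zeta> ?p - DB \<zeta> ?p') + norm (DB \<zeta> ?p' - DB \<zeta>' ?p')"
      using norm_triangle_ineq[of "DB \<zeta> ?p - DB \<zeta> ?p'" "DB \<zeta> ?p' - DB \<zeta>' ?p'"] by simp
    also have "norm (DB \<zeta> ?p - DB \<zeta> ?p') \<le> ?L * ?d"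
      by (rule order_trans[OF DB_lipschitz mult_left_mono[OF norm_pos_diff_le L]])
    finally show ?thesis using DB_diff_le[of \<zeta> ?p' \<zeta>'] by linarith
  qed
  have "(DB \<zeta> ?p o\<^sub>L ?J) - (DB \<zeta>' ?p' o\<^sub>L ?J') = (DB \<zeta> ?p o\<^sub>L (?J - ?J')) + ((DB \<zeta> ?p - DB \<zeta>' ?p') o\<^sub>L ?J')"
    by (intro blinfun_eqI) (simp add: blinfun.bilinear_simps)
  also have "norm \<dots> \<le> norm (DB \<zeta> ?p) * norm (?J - ?J') + norm (DB \<zeta> ?p - DB \<zeta>' ?p') * norm ?J'"
    by (intro norm_triangle_le add_mono norm_blinfun_compose)
  also have "\<dots> \<le> ?L * ?d + (?L * ?d + CB * ?w) * (1 + norm y')"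
    using L CB_pos weak_norm_nonneg[of "\<zeta> - \<zeta>'"]
    by (intro add_mono mult_mono DB_bound norm_jac_diff_le norm_jac_le 2) auto
  finally have 3: "norm ((DB \<zeta> ?p o\<^sub>L ?J) - (DB \<zeta>' ?p' o\<^sub>L ?J')) \<le> \<dots>" .
  have "norm (apply_bcontfun (flow_field \<zeta> y - flow_field \<zeta>' y') x) \<le>
      norm (B \<zeta> ?p - B \<zeta>' ?p') + norm ((DB \<zeta> ?p o\<^sub>L ?J) - (DB \<zeta>' ?p' o\<^sub>L ?J'))"
    by (simp add: apply_flow_field norm_Pair_le)
  also note add_mono[OF 1 3]
  finally show "norm (apply_bcontfun (flow_field \<zeta> y - flow_field \<zeta>' y') x) \<le>
      ?L * (3 + norm y') * ?d + CB * (2 + norm y') * ?w"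
    by (simp add: algebra_simps)
qed

lemma continuous_on_flow_field:
  assumes \<xi>: "weakly_continuous_on {a..b} \<xi>" and y: "continuous_on {a..b} y"
  shows "continuous_on {a..b} (\<lambda>t. flow_field (\<xi> t) (y t))"
  unfolding continuous_on_def
proof
  fix t assume t: "t \<in> {a..b}"
  let ?F = "at t within {a..b}"
  obtain K where K: "0 \<le> K" "\<And>t. t \<in> {a..b} \<Longrightarrow> weak_norm (\<xi> t) \<le> K"
    using weakly_continuous_on_bounded[OF \<xi>] by blast
  let ?u = "\<lambda>s. CB * (K + 1) * (3 + norm (y t)) * norm (y s - y t) + CB * (2 + norm (y t)) * weak_norm (\<xi> s - \<xi> t)"
  have "((\<lambda>s. flow_field (\<xi> s) (y s) - flow_field (\<xi> t) (y t)) \<longlongrightarrow> 0) ?F"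
  proof (rule Lim_null_comparison)
    show "\<forall>\<^sub>F s in ?F. norm (flow_field (\<xi> s) (y s) - flow_field (\<xi> t) (y t)) \<le> ?u s"
      unfolding eventually_at_topological
    proof (intro exI[of _ UNIV] conjI ballI impI)
      fix s assume s: "s \<in> {a..b}"
      have "CB * (weak_norm (\<xi> s) + 1) * (3 + norm (y t)) * norm (y s - y t)
          \<le> CB * (K + 1) * (3 + norm (y t)) * norm (y s - y t)"
        using K(2)[OF s] CB_pos by (intro mult_right_mono) auto
      with norm_flow_field_diff_le[of "\<xi> s" "y s" "\<xi> t" "y t"]
      show "norm (flow_field (\<xi> s) (y s) - flow_field (\<xi> t) (y t)) \<le> ?u s" by linarith
    qed auto
    have "(y \<longlongrightarrow> y t) ?F" using y t by (auto simp: continuous_on_def)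
    moreover have "((\<lambda>s. weak_norm (\<xi> s - \<xi> t)) \<longlongrightarrow> 0) ?F"
      using \<xi> t by (auto simp: weakly_continuous_on_def)
    ultimately have "(?u \<longlongrightarrow> CB * (K + 1) * (3 + norm (y t)) * norm (y t - y t) + CB * (2 + norm (y t)) * 0) ?F"
      by (intro tendsto_intros)
    then show "(?u \<longlongrightarrow> 0) ?F" by simp
  qed
  then show "((\<lambda>s. flow_field (\<xi> s) (y s)) \<longlongrightarrow> flow_field (\<xi> t) (y t)) ?F" by (rule LIM_zero_cancel)
qed


text \<open>The path \<xi> is prescribed; the flow equation is the case where it equals
  \<open>\<lambda>t. push_current \<xi>0 (y t)\<close>. Neither the initial time nor the initial
  state is fixed, which permits restarting.\<close>

definition flow_curve :: "real \<Rightarrow> real \<Rightarrow> (real \<Rightarrow> 'a current) \<Rightarrow> (real \<Rightarrow> 'a flow_state) \<Rightarrow> bool" where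
  "flow_curve a b \<xi> y \<longleftrightarrow>
     (\<forall>t\<in>{a..b}. (y has_vector_derivative flow_field (\<xi> t) (y t)) (at t within {a..b}))"

lemma flow_curve_subset:
  "flow_curve a b \<xi> y \<Longrightarrow> a \<le> c \<Longrightarrow> d \<le> b \<Longrightarrow> flow_curve c d \<xi> y"
  unfolding flow_curve_def
  by (meson atLeastAtMost_iff atLeastatMost_subset_iff has_vector_derivative_within_subset order_trans)

lemma flow_curve_cong:
  "(\<And>t. t \<in> {a..b} \<Longrightarrow> \<xi> t = \<zeta> t) \<Longrightarrow> flow_curve a b \<xi> y \<longleftrightarrow> flow_curve a b \<zeta> y"
  unfolding flow_curve_def by auto

lemma flow_curve_continuous_on: "flow_curve a b \<xi> y \<Longrightarrow> continuous_on {a..b} y"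
  unfolding flow_curve_def
  by (meson has_vector_derivative_continuous continuous_on_eq_continuous_within)

lemma flow_curve_exists:
  assumes \<xi>: "weakly_continuous_on {a..b} \<xi>" and ab: "a \<le> b"
  obtains y where "y a = 0" "flow_curve a b \<xi> y"
proof -
  obtain K where K: "0 \<le> K" "\<And>t. t \<in> {a..b} \<Longrightarrow> weak_norm (\<xi> t) \<le> K"
    using weakly_continuous_on_bounded[OF \<xi>] by blast
  define C where "C = CB * (K + 1)"
  have C: "0 < C" using CB_pos K by (simp add: C_def)
  have CK: "CB * (weak_norm (\<xi> t) + 1) \<le> C" if "t \<in> {a..b}" for t
    unfolding C_def using K(2)[OF that] CB_pos by (intro mult_left_mono) auto
  \<comment> \<open>The solution of \<rho>' = C (2 + \<rho>) with \<rho>(a) = 0. It matches the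
    linear growth of the field and exists on the whole interval.\<close>
  define \<rho> where "\<rho> t = 2 * exp (C * (t - a)) - 2" for t
  have mono: "\<rho> s \<le> \<rho> t" if "s \<le> t" for s t
    using that C by (simp add: \<rho>_def)
  have \<rho>b: "0 \<le> \<rho> b" using mono[OF ab] by (simp add: \<rho>_def)
  obtain y where "y a = 0"
    "\<And>t. t \<in> {a..b} \<Longrightarrow> (y has_vector_derivative flow_field (\<xi> t) (y t)) (at t within {a..b})"
  proof (rule picard_lindelof[of "C * (3 + \<rho> b)" a b \<rho> "\<lambda>t. C * (2 + \<rho> t)" 0 "\<lambda>t. flow_field (\<xi> t)"])
    show "0 < C * (3 + \<rho> b)" using C \<rho>b by simp
    show "norm (0 :: 'a flow_state) \<le> \<rho> a" by (simp add: \<rho>_def)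
    fix t assume t: "t \<in> {a..b}"
    show "(\<rho> has_vector_derivative C * (2 + \<rho> t)) (at t within {a..b})"
      unfolding has_real_derivative_iff_has_vector_derivative[symmetric] \<rho>_def
      by (auto intro!: derivative_eq_intros)
    fix x :: "'a flow_state" assume x: "norm x \<le> \<rho> t"
    have "norm (flow_field (\<xi> t) x) \<le> CB * (weak_norm (\<xi> t) + 1) * (2 + norm x)"
      by (rule norm_flow_field_le)
    also have "\<dots> \<le> C * (2 + \<rho> t)"
      using CK[OF t] C x by (intro mult_mono) auto
    finally show "norm (flow_field (\<xi> t) x) \<le> C * (2 + \<rho> t)" .
    fix z :: "'a flow_state" assume z: "norm z \<le> \<rho> t"
    have "norm (flow_field (\<xi> t) x - flow_field (\<xi> t) z)
        \<le> CB * (weak_norm (\<xi> t) + 1) * (3 + norm z) * norm (x - z)"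
      using norm_flow_field_diff_le[of "\<xi> t" x "\<xi> t" z] by simp
    also have "\<dots> \<le> C * (3 + \<rho> b) * norm (x - z)"
      using CK[OF t] C z mono[of t b] t by (intro mult_right_mono mult_mono) auto
    finally show "norm (flow_field (\<xi> t) x - flow_field (\<xi> t) z) \<le> C * (3 + \<rho> b) * norm (x - z)" .
  qed (use ab mono \<xi> in \<open>auto intro: continuous_on_flow_field\<close>)
  then show ?thesis by (intro that[of y]) (auto simp: flow_curve_def)
qed

lemma flow_pos_has_vector_derivative:
  assumes "flow_curve a b \<xi> y" "t \<in> {a..b}"
  shows "((\<lambda>s. flow_pos (y s) x) has_vector_derivative B (\<xi> t) (flow_pos (y t) x)) (at t within {a..b})"
proof -
  have "bounded_linear (\<lambda>z::'a flow_state. fst (apply_bcontfun z x))"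
  proof (rule bounded_linear_intro[where K=1])
    show "norm (fst (apply_bcontfun z x)) \<le> norm z * 1" for z :: "'a flow_state"
      using norm_bounded[of z x] by (metis mult_1_right norm_fst_le order_trans prod.collapse)
  qed simp_all
  from bounded_linear.has_vector_derivative[OF this] assms
  have "((\<lambda>s. fst (apply_bcontfun (y s) x)) has_vector_derivative B (\<xi> t) (flow_pos (y t) x)) (at t within {a..b})"
    unfolding flow_curve_def by (metis apply_flow_field fst_conv)
  then show ?thesis
    unfolding flow_pos_def by (auto intro!: derivative_eq_intros)
qed

lemma flow_jac_has_vector_derivative:
  assumes "flow_curve a b \<xi> y" "t \<in> {a..b}"
  shows "((\<lambda>s. flow_jac (y s) x) has_vector_derivative
    (DB (\<xi> t) (flow_pos (y t) x) o\<^sub>L flow_jac (y t) x)) (at t within {a..b})"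
proof -
  have "bounded_linear (\<lambda>z::'a flow_state. snd (apply_bcontfun z x))"
  proof (rule bounded_linear_intro[where K=1])
    show "norm (snd (apply_bcontfun z x)) \<le> norm z * 1" for z :: "'a flow_state"
      using norm_bounded[of z x] by (metis mult_1_right norm_snd_le order_trans prod.collapse)
  qed simp_all
  from bounded_linear.has_vector_derivative[OF this] assms
  have "((\<lambda>s. snd (apply_bcontfun (y s) x)) has_vector_derivative
      (DB (\<xi> t) (flow_pos (y t) x) o\<^sub>L flow_jac (y t) x)) (at t within {a..b})"
    unfolding flow_curve_def by (metis apply_flow_field snd_conv)
  then show ?thesis
    unfolding flow_jac_def by (auto intro!: derivative_eq_intros)
qed

lemma B_DB_bounds:
  assumes "weak_norm \<zeta> \<le> K"
  shows "norm (B \<zeta> p - B \<zeta> q) \<le> CB * (K + 1) * norm (p - q)"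
    and "norm (DB \<zeta> p) \<le> CB * (K + 1)"
    and "norm (DB \<zeta> p - DB \<zeta> q) \<le> CB * (K + 1) * norm (p - q)"
    and "norm (B \<zeta> q - B \<zeta> p - blinfun_apply (DB \<zeta> p) (q - p)) \<le> CB * (K + 1) * (norm (q - p))\<^sup>2"
proof -
  have le: "CB * (weak_norm \<zeta> + 1) \<le> CB * (K + 1)"
    using assms CB_pos by simp
  show "norm (B \<zeta> p - B \<zeta> q) \<le> CB * (K + 1) * norm (p - q)"
    by (rule order_trans[OF B_lipschitz mult_right_mono[OF le]]) simp
  show "norm (DB \<zeta> p) \<le> CB * (K + 1)"
    by (rule order_trans[OF DB_bound le])
  show "norm (DB \<zeta> p - DB \<zeta> q) \<le> CB * (K + 1) * norm (p - q)"
    by (rule order_trans[OF DB_lipschitz mult_right_mono[OF le]]) simp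
  show "norm (B \<zeta> q - B \<zeta> p - blinfun_apply (DB \<zeta> p) (q - p)) \<le> CB * (K + 1) * (norm (q - p))\<^sup>2"
    by (rule order_trans[OF B_linearization mult_right_mono[OF le]]) simp
qed

section \<open>Spatial regularity of the flow under a bound on the current\<close>

context
  fixes a b K L :: real and \<xi> :: "real \<Rightarrow> 'a current" and y :: "real \<Rightarrow> 'a flow_state"
  assumes y: "flow_curve a b \<xi> y" "y a = 0" and ab: "a \<le> b"
    and K: "\<And>t. t \<in> {a..b} \<Longrightarrow> weak_norm (\<xi> t) \<le> K"
  defines "L \<equiv> CB * (K + 1)"
begin

lemma L_nonneg: "0 \<le> L"
  using B_DB_bounds(2)[OF K[of a]] ab by (auto simp: L_def intro: order_trans[OF norm_ge_zero])

lemma flow_pos_lipschitz: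
  assumes t: "t \<in> {a..b}"
  shows "norm (flow_pos (y t) p - flow_pos (y t) q) \<le> norm (p - q) * exp (L * (t - a))"
proof -
  have "norm (flow_pos (y t) p - flow_pos (y t) q)
      \<le> (norm (flow_pos (y a) p - flow_pos (y a) q) + 0 * (t - a)) * exp (L * (t - a))"
    by (rule gronwall[of a b "\<lambda>t. flow_pos (y t) p - flow_pos (y t) q"
          "\<lambda>t. B (\<xi> t) (flow_pos (y t) p) - B (\<xi> t) (flow_pos (y t) q)"])
      (use t L_nonneg in \<open>auto intro!: has_vector_derivative_diff flow_pos_has_vector_derivative[OF y(1)]
         B_DB_bounds(1)[OF K] simp: L_def\<close>)
  then show ?thesis by (simp add: y)
qed

lemma flow_jac_bound:
  assumes t: "t \<in> {a..b}"
  shows "norm (flow_jac (y t) p) \<le> exp (L * (t - a))"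
proof -
  have "norm (flow_jac (y t) p) \<le> (norm (flow_jac (y a) p) + 0 * (t - a)) * exp (L * (t - a))"
  proof (rule gronwall[of a b "\<lambda>t. flow_jac (y t) p" "\<lambda>t. DB (\<xi> t) (flow_pos (y t) p) o\<^sub>L flow_jac (y t) p"])
    fix s assume s: "s \<in> {a..b}"
    show "((\<lambda>t. flow_jac (y t) p) has_vector_derivative
        (DB (\<xi> s) (flow_pos (y s) p) o\<^sub>L flow_jac (y s) p)) (at s within {a..b})"
      by (rule flow_jac_has_vector_derivative[OF y(1) s])
    have "norm (DB (\<xi> s) (flow_pos (y s) p) o\<^sub>L flow_jac (y s) p)
        \<le> norm (DB (\<xi> s) (flow_pos (y s) p)) * norm (flow_jac (y s) p)"
      by (rule norm_blinfun_compose)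
    also have "\<dots> \<le> L * norm (flow_jac (y s) p)"
      unfolding L_def by (intro mult_right_mono B_DB_bounds K s) simp
    finally show "norm (DB (\<xi> s) (flow_pos (y s) p) o\<^sub>L flow_jac (y s) p) \<le> L * norm (flow_jac (y s) p) + 0"
      by simp
  qed (use t L_nonneg in auto)
  also have "\<dots> \<le> 1 * exp (L * (t - a))"
    using norm_blinfun_id_le[where 'a='a] by (intro mult_right_mono) (auto simp: y)
  finally show ?thesis by simp
qed

lemma exp_mono_on: "t \<in> {a..b} \<Longrightarrow> exp (L * (t - a)) \<le> exp (L * (b - a))"
  using L_nonneg by (auto intro: mult_left_mono)

text \<open>Gronwall for the difference of two variational equations: the source compares DB at two
  positions, and one factor of the exponential each comes from the position, the Jacobian and
  Gronwall itself. The factor b - a makes the constant vanish for short times.\<close>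

lemma flow_jac_lipschitz:
  "norm (flow_jac (y b) p - flow_jac (y b) q)
    \<le> L * (b - a) * exp (L * (b - a)) ^ 3 * norm (p - q)"
proof -
  let ?E = "exp (L * (b - a))"
  let ?P = "\<lambda>t. flow_pos (y t)" and ?J = "\<lambda>t. flow_jac (y t)"
  have "norm (?J b p - ?J b q)
      \<le> (norm (?J a p - ?J a q) + L * ?E\<^sup>2 * norm (p - q) * (b - a)) * exp (L * (b - a))"
  proof (rule gronwall[of a b "\<lambda>t. ?J t p - ?J t q"
        "\<lambda>t. (DB (\<xi> t) (?P t p) o\<^sub>L ?J t p) - (DB (\<xi> t) (?P t q) o\<^sub>L ?J t q)"])
    fix s assume s: "s \<in> {a..b}"
    show "((\<lambda>t. ?J t p - ?J t q) has_vector_derivative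
        (DB (\<xi> s) (?P s p) o\<^sub>L ?J s p) - (DB (\<xi> s) (?P s q) o\<^sub>L ?J s q)) (at s within {a..b})"
      by (intro has_vector_derivative_diff flow_jac_has_vector_derivative[OF y(1) s])
    have "(DB (\<xi> s) (?P s p) o\<^sub>L ?J s p) - (DB (\<xi> s) (?P s q) o\<^sub>L ?J s q)
        = (DB (\<xi> s) (?P s p) o\<^sub>L (?J s p - ?J s q)) + ((DB (\<xi> s) (?P s p) - DB (\<xi> s) (?P s q)) o\<^sub>L ?J s q)"
      by (intro blinfun_eqI) (simp add: blinfun.bilinear_simps)
    also have "norm \<dots> \<le> norm (DB (\<xi> s) (?P s p)) * norm (?J s p - ?J s q)
        + norm (DB (\<xi> s) (?P s p) - DB (\<xi> s) (?P s q)) * norm (?J s q)"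
      by (intro norm_triangle_le add_mono norm_blinfun_compose)
    also have "\<dots> \<le> L * norm (?J s p - ?J s q) + (L * (norm (p - q) * ?E)) * ?E"
    proof (intro add_mono mult_mono)
      show "norm (DB (\<xi> s) (?P s p)) \<le> L" unfolding L_def by (intro B_DB_bounds K s)
      have "norm (DB (\<xi> s) (?P s p) - DB (\<xi> s) (?P s q)) \<le> L * norm (?P s p - ?P s q)"
        unfolding L_def by (intro B_DB_bounds K s)
      also have "\<dots> \<le> L * (norm (p - q) * ?E)"
        by (intro mult_left_mono L_nonneg order_trans[OF flow_pos_lipschitz[OF s]] exp_mono_on s) simp
      finally show "norm (DB (\<xi> s) (?P s p) - DB (\<xi> s) (?P s q)) \<le> L * (norm (p - q) * ?E)" .
      show "norm (?J s q) \<le> ?E" using flow_jac_bound[OF s] exp_mono_on[OF s] order_trans by blast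
    qed (use L_nonneg in auto)
    finally show "norm ((DB (\<xi> s) (?P s p) o\<^sub>L ?J s p) - (DB (\<xi> s) (?P s q) o\<^sub>L ?J s q))
        \<le> L * norm (?J s p - ?J s q) + L * ?E\<^sup>2 * norm (p - q)"
      by (simp add: power2_eq_square mult_ac)
  qed (use ab L_nonneg in auto)
  then show ?thesis by (simp add: y power2_eq_square power3_eq_cube mult_ac)
qed

text \<open>The first-order remainder r starts at 0 and satisfies r' = DB r + (Taylor error of B),
  the error being quadratic in the distance of the two positions and hence in |q - p|. Gronwall
  preserves this order.\<close>

lemma flow_pos_has_derivative:
  "(flow_pos (y b) has_derivative blinfun_apply (flow_jac (y b) p)) (at p)"
proof -
  let ?E = "exp (L * (b - a))" and ?P = "\<lambda>t. flow_pos (y t)" and ?J = "\<lambda>t. flow_jac (y t) p"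
  define C where "C = L * (b - a) * ?E ^ 3"
  have C: "0 \<le> C" using L_nonneg ab by (simp add: C_def)
  have est: "norm (?P b q - ?P b p - blinfun_apply (?J b) (q - p)) \<le> C * (norm (q - p))\<^sup>2" for q
  proof -
    let ?r = "\<lambda>t. ?P t q - ?P t p - blinfun_apply (?J t) (q - p)"
    let ?r' = "\<lambda>t. B (\<xi> t) (?P t q) - B (\<xi> t) (?P t p) - blinfun_apply (DB (\<xi> t) (?P t p) o\<^sub>L ?J t) (q - p)"
    have "norm (?r b) \<le> (norm (?r a) + L * ?E\<^sup>2 * (norm (q - p))\<^sup>2 * (b - a)) * exp (L * (b - a))"
    proof (rule gronwall[of a b ?r ?r'])
      fix s assume s: "s \<in> {a..b}"
      show "(?r has_vector_derivative ?r' s) (at s within {a..b})"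
        by (intro has_vector_derivative_diff flow_pos_has_vector_derivative[OF y(1) s]
            bounded_linear.has_vector_derivative[OF blinfun.bounded_linear_left] flow_jac_has_vector_derivative[OF y(1) s])
      have "?r' s = (B (\<xi> s) (?P s q) - B (\<xi> s) (?P s p) - blinfun_apply (DB (\<xi> s) (?P s p)) (?P s q - ?P s p))
          + blinfun_apply (DB (\<xi> s) (?P s p)) (?r s)"
        by (simp add: blinfun.bilinear_simps)
      also have "norm \<dots> \<le> L * (norm (?P s q - ?P s p))\<^sup>2 + L * norm (?r s)"
        unfolding L_def
        by (intro norm_triangle_le add_mono B_DB_bounds K s order_trans[OF norm_blinfun] mult_right_mono) simp
      also have "L * (norm (?P s q - ?P s p))\<^sup>2 \<le> L * (norm (q - p) * ?E)\<^sup>2"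
        by (intro mult_left_mono[OF _ L_nonneg] power_mono order_trans[OF flow_pos_lipschitz[OF s]]
            mult_left_mono exp_mono_on s) auto
      finally show "norm (?r' s) \<le> L * norm (?r s) + L * ?E\<^sup>2 * (norm (q - p))\<^sup>2"
        by (simp add: power_mult_distrib mult_ac)
    qed (use ab L_nonneg in auto)
    then show ?thesis
      by (simp add: y C_def power2_eq_square power3_eq_cube mult_ac)
  qed
  show ?thesis
    unfolding has_derivative_at_alt
  proof (intro conjI allI impI)
    show "bounded_linear (blinfun_apply (?J b))" by (rule blinfun.bounded_linear_right)
    fix e :: real assume e: "e > 0"
    show "\<exists>d>0. \<forall>q. norm (q - p) < d \<longrightarrow>
        norm (?P b q - ?P b p - blinfun_apply (?J b) (q - p)) \<le> e * norm (q - p)"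
    \<comment> \<open>The summand 1 covers C = 0, which occurs for instance when b = a.\<close>
    proof (intro exI[of _ "e / (C + 1)"] conjI allI impI)
      show "0 < e / (C + 1)" using e C by simp
      fix q assume "norm (q - p) < e / (C + 1)"
      then have "(C + 1) * norm (q - p) \<le> e" using C by (simp add: field_simps)
      then have "C * norm (q - p) \<le> e" using norm_ge_zero[of "q - p"] unfolding distrib_right by linarith
      then have "C * norm (q - p) * norm (q - p) \<le> e * norm (q - p)"
        by (intro mult_right_mono) auto
      with est[of q] show "norm (?P b q - ?P b p - blinfun_apply (?J b) (q - p)) \<le> e * norm (q - p)"
        by (simp add: power2_eq_square mult.assoc)
    qed
  qed
qed

text \<open>With E bounding the expansion of the flow, the pulled-back field has sup norm at most E
  |\<theta>| and Lipschitz constant at most E^2 l + L (b - a) E^3 |\<theta>|; it is therefore a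
  multiple of a test field.\<close>

lemma apply_pull_field_le:
  assumes \<theta>: "\<theta> \<in> weak_tests" and small: "L * (b - a) \<le> 1 / 8"
  shows "blinfun_apply \<zeta> (pull_field (y b) \<theta>) \<le> 2 * weak_norm \<zeta>"
proof -
  obtain l where l: "0 \<le> l" "norm \<theta> + l \<le> 1"
    "\<And>x y. norm (apply_bcontfun \<theta> x - apply_bcontfun \<theta> y) \<le> l * norm (x - y)"
    using \<theta> by (elim weak_testsE) blast
  define E where "E = exp (L * (b - a))"
  have E1: "1 \<le> E" using L_nonneg ab by (simp add: E_def)
  \<comment> \<open>Bounding exp(-1/8) from below by its tangent line gives E \<le> 8/7 without
    numerical estimates of exp.\<close>
  have "7 / 8 \<le> exp (- (L * (b - a)))"
    using exp_ge_add_one_self[of "- (L * (b - a))"] small by linarith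
  also have "\<dots> = 1 / E" by (simp add: E_def exp_minus inverse_eq_divide)
  finally have E2: "E \<le> 8 / 7" using E1 by (simp add: field_simps)
  have bE: "b \<in> {a..b}" using ab by simp
  have J: "norm (flow_jac (y b) p) \<le> E" for p
    using flow_jac_bound[OF bE] by (simp add: E_def)
  have t: "norm (apply_bcontfun \<theta> p) \<le> norm \<theta>" for p by (rule norm_bounded)
  have "norm (pull_field (y b) \<theta>) \<le> E * norm \<theta>"
    using E1 by (intro norm_bound, unfold apply_pull_field)
      (intro order_trans[OF norm_adjoint_blinfun_le] mult_mono J t, auto)
  moreover have "(E * (l * E) + L * (b - a) * E ^ 3 * norm \<theta>)-lipschitz_on UNIV (apply_bcontfun (pull_field (y b) \<theta>))"
  proof (rule lipschitz_onI)
    fix p q :: 'a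
    let ?J = "flow_jac (y b)" and ?P = "flow_pos (y b)" and ?t = "apply_bcontfun \<theta>"
    have "apply_bcontfun (pull_field (y b) \<theta>) p - apply_bcontfun (pull_field (y b) \<theta>) q =
      adjoint (blinfun_apply (?J p)) (?t (?P p) - ?t (?P q)) + adjoint (blinfun_apply (?J p - ?J q)) (?t (?P q))"
      by (simp only: apply_pull_field adj.diff_left adj.diff_right) simp
    also have "norm \<dots> \<le> norm (?J p) * norm (?t (?P p) - ?t (?P q)) + norm (?J p - ?J q) * norm (?t (?P q))"
      by (intro norm_triangle_le add_mono norm_adjoint_blinfun_le)
    also have "\<dots> \<le> E * (l * (norm (p - q) * E)) + L * (b - a) * E ^ 3 * norm (p - q) * norm \<theta>"
    proof (intro add_mono mult_mono J t)
      show "norm (?t (?P p) - ?t (?P q)) \<le> l * (norm (p - q) * E)"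
        using flow_pos_lipschitz[OF bE, of p q] l(1)
        by (intro order_trans[OF l(3)] mult_left_mono) (auto simp: E_def)
      show "norm (?J p - ?J q) \<le> L * (b - a) * E ^ 3 * norm (p - q)"
        unfolding E_def by (rule flow_jac_lipschitz)
    qed (use E1 L_nonneg ab in auto)
    finally show "dist (apply_bcontfun (pull_field (y b) \<theta>) p) (apply_bcontfun (pull_field (y b) \<theta>) q)
        \<le> (E * (l * E) + L * (b - a) * E ^ 3 * norm \<theta>) * dist p q"
      by (simp add: dist_norm algebra_simps)
  qed (use E1 L_nonneg ab l in auto)
  moreover have "E * norm \<theta> + (E * (l * E) + L * (b - a) * E ^ 3 * norm \<theta>) \<le> 2"
  proof -
    \<comment> \<open>Raising E to E^2 groups |\<theta>| with l. The total is at most (8/7)^2 +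
      (1/8) (8/7)^3 = 512/343, below 2.\<close>
    have "E * norm \<theta> \<le> E\<^sup>2 * norm \<theta>"
      using E1 by (intro mult_right_mono) (auto simp: power2_eq_square)
    moreover have "E\<^sup>2 * (norm \<theta> + l) \<le> (8/7)\<^sup>2 * 1"
      using E1 E2 l by (intro mult_mono power_mono) auto
    moreover have "L * (b - a) * E ^ 3 * norm \<theta> \<le> 1/8 * (8/7) ^ 3 * 1"
      using E1 E2 l small L_nonneg ab by (intro mult_mono power_mono) auto
    ultimately show ?thesis by (simp add: power2_eq_square power3_eq_cube algebra_simps)
  qed
  ultimately show ?thesis
    by (intro apply_le_mult_weak_norm[of "E * (l * E) + L * (b - a) * E ^ 3 * norm \<theta>"]) auto
qed

end


section \<open>Solutions of the flow equation as curves of states\<close>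

lemma is_solution_weakly_continuous:
  "is_solution B \<xi>0 T \<xi> \<Longrightarrow> weakly_continuous_on {0..T} \<xi>"
  by (simp add: is_solution_def weakly_continuous_on_iff)

text \<open>The state equation is solved along the solution's own currents. Uniqueness for x' = B(x)
  identifies the position, and uniqueness of derivatives then identifies the Jacobian, so the
  variational equation is never derived for the given \<open>D\<phi>\<close>.\<close>

lemma is_solution_flow_curve:
  assumes sol: "is_solution B \<xi>0 T \<xi>" and T: "0 \<le> T"
  obtains y where "y 0 = 0" "flow_curve 0 T \<xi> y" "\<And>t. t \<in> {0..T} \<Longrightarrow> \<xi> t = push_current \<xi>0 (y t)"
proof -
  note wc = is_solution_weakly_continuous[OF sol]
  obtain K where K: "0 \<le> K" "\<And>t. t \<in> {0..T} \<Longrightarrow> weak_norm (\<xi> t) \<le> K"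
    using weakly_continuous_on_bounded[OF wc] by blast
  obtain \<phi> D\<phi> where \<phi>: "is_flow B \<xi> T \<phi>"
    and D\<phi>: "\<And>t x. t \<in> {0..T} \<Longrightarrow> (\<phi> t has_derivative blinfun_apply (D\<phi> t x)) (at x)"
    and \<xi>: "\<And>t \<theta>. t \<in> {0..T} \<Longrightarrow>
      blinfun_apply (\<xi> t) \<theta> = blinfun_apply \<xi>0 (Bcontfun (push_field (\<phi> t) (D\<phi> t) \<theta>))"
    using sol unfolding is_solution_def by blast
  obtain y where y: "y 0 = 0" "flow_curve 0 T \<xi> y"
    using flow_curve_exists[OF wc T] by blast
  have "\<xi> t = push_current \<xi>0 (y t)" if t: "t \<in> {0..T}" for t
  proof -
    have pos: "\<phi> t = flow_pos (y t)"
    proof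
      fix x
      show "\<phi> t x = flow_pos (y t) x"
      proof (rule ode_unique[where f = "\<lambda>t. B (\<xi> t)" and p = "\<lambda>t. \<phi> t x" and q = "\<lambda>t. flow_pos (y t) x"
            and L = "CB * (K + 1)"])
        fix s assume s: "s \<in> {0..T}"
        show "((\<lambda>t. \<phi> t x) has_vector_derivative B (\<xi> s) (\<phi> s x)) (at s within {0..T})"
          using \<phi> s by (auto simp: is_flow_def)
        show "((\<lambda>t. flow_pos (y t) x) has_vector_derivative B (\<xi> s) (flow_pos (y s) x)) (at s within {0..T})"
          by (rule flow_pos_has_vector_derivative[OF y(2) s])
        show "norm (B (\<xi> s) (\<phi> s x) - B (\<xi> s) (flow_pos (y s) x)) \<le> CB * (K + 1) * norm (\<phi> s x - flow_pos (y s) x)"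
          by (rule B_DB_bounds(1)[OF K(2)[OF s]])
      qed (use \<phi> y t K CB_pos in \<open>auto simp: is_flow_def\<close>)
    qed
    have "D\<phi> t x = flow_jac (y t) x" for x
    proof -
      have "(flow_pos (y t) has_derivative blinfun_apply (flow_jac (y t) x)) (at x)"
        using t y K by (intro flow_pos_has_derivative[of 0 t \<xi> y K] flow_curve_subset[OF y(2)]) auto
      with D\<phi>[OF t, of x] pos show ?thesis
        by (metis blinfun_apply_inject has_derivative_unique)
    qed
    then have "D\<phi> t = flow_jac (y t)" by blast
    with pos \<xi>[OF t] show ?thesis
      by (intro blinfun_eqI) (simp add: apply_push_current pull_field_def)
  qed
  with y show ?thesis by (intro that[of y])
qed

lemma flow_curve_is_solution:
  assumes y: "y 0 = 0" "flow_curve 0 T (\<lambda>t. push_current \<xi>0 (y t)) y"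
  shows "is_solution B \<xi>0 T (\<lambda>t. push_current \<xi>0 (y t))"
  unfolding is_solution_def weakly_continuous_on_iff[symmetric]
proof (intro conjI exI[of _ "\<lambda>t. flow_pos (y t)"] exI[of _ "\<lambda>t. flow_jac (y t)"] ballI allI)
  let ?\<xi> = "\<lambda>t. push_current \<xi>0 (y t)"
  show wc: "weakly_continuous_on {0..T} ?\<xi>"
    by (intro weakly_continuous_on_push_current flow_curve_continuous_on[OF y(2)])
  obtain K where K: "\<And>t. t \<in> {0..T} \<Longrightarrow> weak_norm (?\<xi> t) \<le> K"
    using weakly_continuous_on_bounded[OF wc] by blast
  show "is_flow B ?\<xi> T (\<lambda>t. flow_pos (y t))"
    unfolding is_flow_def using flow_pos_has_vector_derivative[OF y(2)] by (simp add: y)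
  fix t assume t: "t \<in> {0..T}"
  show "(flow_pos (y t) has_derivative blinfun_apply (flow_jac (y t) x)) (at x)" for x
    using t y K by (intro flow_pos_has_derivative[of 0 t ?\<xi> y K] flow_curve_subset[OF y(2)]) auto
  show "push_field (flow_pos (y t)) (flow_jac (y t)) \<theta> \<in> bcontfun" for \<theta>
    by (rule push_field_bcontfun)
  show "blinfun_apply (?\<xi> t) \<theta> = blinfun_apply \<xi>0 (Bcontfun (push_field (flow_pos (y t)) (flow_jac (y t)) \<theta>))" for \<theta>
    by (simp add: apply_push_current pull_field_def)
qed

text \<open>A Lipschitz constant on the ball of radius R. The first summand is the dependence on the
  state at fixed current, the second the feedback through the pushed-forward current.\<close>

definition autonomous_lip :: "'a current \<Rightarrow> real \<Rightarrow> real" where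
  "autonomous_lip \<xi>0 R =
     CB * (norm \<xi>0 * (1 + R) + 1) * (3 + R) + CB * (2 + R) * (norm \<xi>0 * (2 + R))"

lemma autonomous_lip_pos: "0 \<le> R \<Longrightarrow> 0 < autonomous_lip \<xi>0 R"
  unfolding autonomous_lip_def using CB_pos by (simp add: add_pos_nonneg add_nonneg_pos)

lemma norm_autonomous_diff_le:
  assumes y: "norm y \<le> R" and z: "norm z \<le> R"
  shows "norm (flow_field (push_current \<xi>0 y) y - flow_field (push_current \<xi>0 z) z)
    \<le> autonomous_lip \<xi>0 R * norm (y - z)"
proof -
  let ?w = "weak_norm (push_current \<xi>0 y)" and ?d = "norm (y - z)"
  have R: "0 \<le> R" using y norm_ge_zero order_trans by blast
  have "?w \<le> norm \<xi>0 * (1 + R)"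
    by (rule order_trans[OF weak_norm_push_current_le]) (use y in \<open>simp add: mult_left_mono\<close>)
  then have "CB * (?w + 1) * (3 + norm z) * ?d \<le> CB * (norm \<xi>0 * (1 + R) + 1) * (3 + R) * ?d"
    using z R CB_pos weak_norm_nonneg[of "push_current \<xi>0 y"] by (intro mult_right_mono mult_mono) auto
  moreover have "CB * (2 + norm z) * weak_norm (push_current \<xi>0 y - push_current \<xi>0 z)
      \<le> CB * (2 + R) * (norm \<xi>0 * ((2 + R) * ?d))"
    using y z R CB_pos
    by (intro mult_mono order_trans[OF weak_norm_push_current_diff_le] mult_left_mono mult_right_mono)
      (auto simp: weak_norm_nonneg)
  ultimately show ?thesis
    using norm_flow_field_diff_le[of "push_current \<xi>0 y" y "push_current \<xi>0 z" z]
    by (simp add: autonomous_lip_def algebra_simps)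
qed

lemma autonomous_unique:
  assumes y: "flow_curve 0 T (\<lambda>t. push_current \<xi>0 (y t)) y"
    and z: "flow_curve 0 T (\<lambda>t. push_current \<xi>0 (z t)) z"
    and "y 0 = z 0" "t \<in> {0..T}"
  shows "y t = z t"
proof -
  have "bounded (y ` {0..T} \<union> z ` {0..T})"
    using flow_curve_continuous_on[OF y] flow_curve_continuous_on[OF z]
    by (simp add: compact_continuous_image compact_imp_bounded)
  then obtain R where R: "0 < R" "\<And>x. x \<in> y ` {0..T} \<union> z ` {0..T} \<Longrightarrow> norm x \<le> R"
    unfolding bounded_pos by blast
  show ?thesis
    by (rule ode_unique[where f = "\<lambda>t y. flow_field (push_current \<xi>0 y) y" and L = "autonomous_lip \<xi>0 R"])
      (use y z assms R autonomous_lip_pos[of R \<xi>0] in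
        \<open>auto simp: flow_curve_def intro!: norm_autonomous_diff_le\<close>)
qed

lemma is_solution_unique:
  assumes "is_solution B \<xi>0 T \<xi>" "is_solution B \<xi>0 T \<xi>'" "t \<in> {0..T}"
  shows "\<xi> t = \<xi>' t"
proof -
  have T: "0 \<le> T" using assms by auto
  obtain y where y: "y 0 = 0" "flow_curve 0 T \<xi> y" "\<And>t. t \<in> {0..T} \<Longrightarrow> \<xi> t = push_current \<xi>0 (y t)"
    using is_solution_flow_curve[OF assms(1) T] by blast
  obtain z where z: "z 0 = 0" "flow_curve 0 T \<xi>' z" "\<And>t. t \<in> {0..T} \<Longrightarrow> \<xi>' t = push_current \<xi>0 (z t)"
    using is_solution_flow_curve[OF assms(2) T] by blast
  have "flow_curve 0 T (\<lambda>t. push_current \<xi>0 (y t)) y"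
    using y(2) flow_curve_cong[of 0 T \<xi>, OF y(3)] by blast
  moreover have "flow_curve 0 T (\<lambda>t. push_current \<xi>0 (z t)) z"
    using z(2) flow_curve_cong[of 0 T \<xi>', OF z(3)] by blast
  ultimately have "y t = z t"
    by (rule autonomous_unique) (use assms(3) y(1) z(1) in auto)
  with y(3) z(3) assms(3) show ?thesis by simp
qed

text \<open>Uniqueness is automatic, so extending the maximal interval only requires a
  solution.\<close>

lemma unique_solution_onI: "is_solution B \<xi>0 T \<xi> \<Longrightarrow> unique_solution_on B \<xi>0 T"
  unfolding unique_solution_on_def by (intro conjI exI allI impI ballI) (assumption | rule is_solution_unique)+

text \<open>The flow from \<open>a\<close> to \<open>b\<close> is the flow from \<open>a\<close> to \<open>s\<close> followed by the one started at \<open>s\<close>;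
  restarting avoids having to invert the flow.\<close>

lemma flow_curve_compose:
  assumes y: "flow_curve a b \<xi> y" and v: "flow_curve s b \<xi> v" "v s = 0" and s: "s \<in> {a..b}"
    and wc: "weakly_continuous_on {a..b} \<xi>"
  shows "flow_pos (y b) x = flow_pos (v b) (flow_pos (y s) x)" (is ?pos)
    and "flow_jac (y b) x = flow_jac (v b) (flow_pos (y s) x) o\<^sub>L flow_jac (y s) x" (is ?jac)
proof -
  obtain K where K: "0 \<le> K" "\<And>t. t \<in> {a..b} \<Longrightarrow> weak_norm (\<xi> t) \<le> K"
    using weakly_continuous_on_bounded[OF wc] by blast
  have y': "flow_curve s b \<xi> y" using y s by (auto intro: flow_curve_subset)
  have K': "weak_norm (\<xi> t) \<le> K" if "t \<in> {s..b}" for t using K that s by auto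
  have L: "0 \<le> CB * (K + 1)" using K CB_pos by simp
  let ?p = "flow_pos (y s) x"
  have pos: "flow_pos (y t) x = flow_pos (v t) ?p" if t: "t \<in> {s..b}" for t
    by (rule ode_unique[where f = "\<lambda>t. B (\<xi> t)" and L = "CB * (K + 1)"])
      (use t L v in \<open>auto intro!: flow_pos_has_vector_derivative[OF y'] flow_pos_has_vector_derivative[OF v(1)]
         B_DB_bounds(1) K'\<close>)
  \<comment> \<open>Once the positions agree, both sides solve the same linear equation A' =
    DB(position) A with equal values at \<open>s\<close>.\<close>
  have "flow_jac (y b) x = flow_jac (v b) ?p o\<^sub>L flow_jac (y s) x"
  proof (rule ode_unique[where f = "\<lambda>t A. DB (\<xi> t) (flow_pos (y t) x) o\<^sub>L A" and L = "CB * (K + 1)"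
        and p = "\<lambda>t. flow_jac (y t) x" and q = "\<lambda>t. flow_jac (v t) ?p o\<^sub>L flow_jac (y s) x"])
    fix t assume t: "t \<in> {s..b}"
    show "((\<lambda>t. flow_jac (y t) x) has_vector_derivative (DB (\<xi> t) (flow_pos (y t) x) o\<^sub>L flow_jac (y t) x)) (at t within {s..b})"
      by (rule flow_jac_has_vector_derivative[OF y' t])
    have "((\<lambda>t. flow_jac (v t) ?p o\<^sub>L flow_jac (y s) x) has_vector_derivative
        ((DB (\<xi> t) (flow_pos (v t) ?p) o\<^sub>L flow_jac (v t) ?p) o\<^sub>L flow_jac (y s) x)) (at t within {s..b})"
      by (rule bounded_linear.has_vector_derivative[OF
            bounded_bilinear.bounded_linear_left[OF bounded_bilinear_blinfun_compose]
            flow_jac_has_vector_derivative[OF v(1) t]])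
    moreover have "(P o\<^sub>L Q) o\<^sub>L R = P o\<^sub>L (Q o\<^sub>L R)" for P Q R :: "'a \<Rightarrow>\<^sub>L 'a"
      by (intro blinfun_eqI) simp
    ultimately show "((\<lambda>t. flow_jac (v t) ?p o\<^sub>L flow_jac (y s) x) has_vector_derivative
        (DB (\<xi> t) (flow_pos (y t) x) o\<^sub>L (flow_jac (v t) ?p o\<^sub>L flow_jac (y s) x))) (at t within {s..b})"
      by (simp only: pos[OF t])
    have "(DB (\<xi> t) (flow_pos (y t) x) o\<^sub>L A) - (DB (\<xi> t) (flow_pos (y t) x) o\<^sub>L C)
        = DB (\<xi> t) (flow_pos (y t) x) o\<^sub>L (A - C)" for A C :: "'a \<Rightarrow>\<^sub>L 'a"
      by (intro blinfun_eqI) (simp add: blinfun.bilinear_simps)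
    then show "norm ((DB (\<xi> t) (flow_pos (y t) x) o\<^sub>L flow_jac (y t) x) -
         (DB (\<xi> t) (flow_pos (y t) x) o\<^sub>L (flow_jac (v t) ?p o\<^sub>L flow_jac (y s) x)))
        \<le> CB * (K + 1) * norm (flow_jac (y t) x - (flow_jac (v t) ?p o\<^sub>L flow_jac (y s) x))"
      by (simp only:) (intro order_trans[OF norm_blinfun_compose] mult_right_mono B_DB_bounds(2) K' t norm_ge_zero)
  next
    show "flow_jac (y s) x = flow_jac (v s) ?p o\<^sub>L flow_jac (y s) x"
      by (intro blinfun_eqI) (simp add: v)
  qed (use s L in auto)
  with pos[of b] s show ?pos ?jac by auto
qed

text \<open>Testing the current at \<open>b\<close> with \<theta> is testing the current at
  \<open>s\<close> with \<theta> pulled back by the flow restarted at \<open>s\<close>. The weak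
  norm at \<open>s\<close> thus replaces the dual norm of \<open>\<xi>0\<close>.\<close>

lemma weak_norm_short_time:
  assumes y: "flow_curve a b \<xi> y" and \<xi>: "\<And>t. t \<in> {a..b} \<Longrightarrow> \<xi> t = push_current \<xi>0 (y t)"
    and s: "s \<in> {a..b}" and K: "\<And>t. t \<in> {s..b} \<Longrightarrow> weak_norm (\<xi> t) \<le> K"
    and small: "CB * (K + 1) * (b - s) \<le> 1 / 8"
  shows "weak_norm (\<xi> b) \<le> 2 * weak_norm (\<xi> s)"
proof (rule weak_norm_leI)
  fix \<theta> :: "'a \<Rightarrow>\<^sub>C 'a" assume \<theta>: "\<theta> \<in> weak_tests"
  have "weakly_continuous_on {a..b} (\<lambda>t. push_current \<xi>0 (y t))"
    by (intro weakly_continuous_on_push_current flow_curve_continuous_on[OF y])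
  then have wc: "weakly_continuous_on {a..b} \<xi>"
    using \<xi> by (simp add: weakly_continuous_on_iff)
  have sb: "s \<le> b" using s by simp
  obtain v where v: "v s = 0" "flow_curve s b \<xi> v"
    using flow_curve_exists[OF weakly_continuous_on_subset[OF wc] sb] s by auto
  have "pull_field (y b) \<theta> = pull_field (y s) (pull_field (v b) \<theta>)"
    by (intro bcontfun_eqI) (simp add: apply_pull_field flow_curve_compose[OF y v(2) v(1) s wc] adjoint_blinfun_compose)
  then have "blinfun_apply (\<xi> b) \<theta> = blinfun_apply (\<xi> s) (pull_field (v b) \<theta>)"
    using s by (simp add: \<xi> apply_push_current)
  also have "\<dots> \<le> 2 * weak_norm (\<xi> s)"
    by (rule apply_pull_field_le[OF v(2) v(1) sb K \<theta> small])
  finally show "blinfun_apply (\<xi> b) \<theta> \<le> 2 * weak_norm (\<xi> s)" .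
qed

text \<open>A continuity argument removes the a priori bound on the whole interval: at the first
  time the level 2 K + 1 is reached, the doubling estimate gives at most 2 K. The added 1 is this
  gap, and 2 K + 2 is the level plus the 1 of the growth bound on B.\<close>

lemma weak_norm_short_time_bound:
  assumes y: "flow_curve a b \<xi> y" and \<xi>: "\<And>t. t \<in> {a..b} \<Longrightarrow> \<xi> t = push_current \<xi>0 (y t)"
    and s: "s \<in> {a..b}" and K: "weak_norm (\<xi> s) \<le> K"
    and small: "CB * (2 * K + 2) * (b - s) \<le> 1 / 8"
  shows "weak_norm (\<xi> b) \<le> 2 * K + 1"
proof (rule ccontr)
  assume "\<not> ?thesis"
  then have big: "2 * K + 1 < weak_norm (\<xi> b)" by simp
  let ?N = "\<lambda>t. weak_norm (\<xi> t)"
  have K0: "0 \<le> K" using K weak_norm_nonneg order_trans by blast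
  have "weakly_continuous_on {a..b} (\<lambda>t. push_current \<xi>0 (y t))"
    by (intro weakly_continuous_on_push_current flow_curve_continuous_on[OF y])
  then have wc: "weakly_continuous_on {a..b} \<xi>"
    using \<xi> by (simp add: weakly_continuous_on_iff)
  have Nc: "continuous_on {s..b} ?N"
    using s by (intro continuous_on_weak_norm weakly_continuous_on_subset[OF wc]) auto
  \<comment> \<open>The first hitting time is \<open>Inf A\<close>; \<open>A\<close> is closed, so
    it is attained.\<close>
  define A where "A = {t \<in> {s..b}. ?N t = 2 * K + 1}"
  have hit: "\<exists>t\<in>A. t \<le> r" if "r \<in> {s..b}" "2 * K + 1 \<le> ?N r" for r
  proof -
    have "\<exists>t\<ge>s. t \<le> r \<and> ?N t = 2 * K + 1"
      using that K K0 by (intro IVT' continuous_on_subset[OF Nc]) auto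
    then show ?thesis using that by (auto simp: A_def)
  qed
  have "closed A"
    unfolding A_def by (intro continuous_closed_preimage_constant Nc) auto
  moreover have "A \<noteq> {}" using hit[of b] big s by auto
  moreover have "bdd_below A" unfolding A_def by (intro bdd_belowI[of _ s]) auto
  ultimately have m: "Inf A \<in> A" by (intro closed_contains_Inf)
  have below: "?N r \<le> 2 * K + 1" if r: "r \<in> {s..Inf A}" for r
  proof (rule ccontr)
    assume "\<not> ?N r \<le> 2 * K + 1"
    with r m obtain t where t: "t \<in> A" "t \<le> r" using hit[of r] by (auto simp: A_def)
    with \<open>bdd_below A\<close> have "Inf A \<le> t" by (intro cInf_lower)
    with t r have "t = r" by simp
    with t \<open>\<not> ?N r \<le> 2 * K + 1\<close> show False by (simp add: A_def)
  qed
  have mb: "Inf A \<in> {s..b}" using m by (simp add: A_def)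
  have "?N (Inf A) \<le> 2 * ?N s"
  proof (rule weak_norm_short_time[of a "Inf A" \<xi> y \<xi>0 s "2 * K + 1"])
    show "flow_curve a (Inf A) \<xi> y" using y mb s by (auto intro: flow_curve_subset)
    have "CB * (2 * K + 2) * (Inf A - s) \<le> CB * (2 * K + 2) * (b - s)"
      using mb CB_pos K0 by (intro mult_left_mono) auto
    then show "CB * (2 * K + 1 + 1) * (Inf A - s) \<le> 1 / 8" using small by (simp add: algebra_simps)
  qed (use \<xi> below mb s in auto)
  moreover have "?N (Inf A) = 2 * K + 1" using m by (simp add: A_def)
  ultimately show False using K by simp
qed

end

section \<open>Blow-up\<close>

context current_transport
begin

text \<open>Gronwall with linear growth: the source 2 C has one part from B and one from the
  identity in the Jacobian. The bound depends on K and t but not on \<open>\<xi>0\<close>.\<close>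

lemma flow_curve_bounded:
  assumes y: "flow_curve 0 T \<xi> y" "y 0 = 0" and K: "0 \<le> K" "\<And>t. t \<in> {0..T} \<Longrightarrow> weak_norm (\<xi> t) \<le> K"
    and t: "t \<in> {0..T}"
  shows "norm (y t) \<le> 2 * (CB * (K + 1)) * t * exp (CB * (K + 1) * t)"
proof -
  let ?C = "CB * (K + 1)"
  have C: "0 \<le> ?C" using K CB_pos by simp
  have "norm (y t) \<le> (norm (y 0) + 2 * ?C * (t - 0)) * exp (?C * (t - 0))"
  proof (rule gronwall[of 0 T y "\<lambda>t. flow_field (\<xi> t) (y t)"])
    fix s assume s: "s \<in> {0..T}"
    show "(y has_vector_derivative flow_field (\<xi> s) (y s)) (at s within {0..T})"
      using y s by (simp add: flow_curve_def)
    have "norm (flow_field (\<xi> s) (y s)) \<le> CB * (weak_norm (\<xi> s) + 1) * (2 + norm (y s))"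
      by (rule norm_flow_field_le)
    also have "\<dots> \<le> ?C * (2 + norm (y s))"
      using K(2)[OF s] CB_pos by (intro mult_right_mono mult_left_mono) auto
    finally show "norm (flow_field (\<xi> s) (y s)) \<le> ?C * norm (y s) + 2 * ?C"
      by (simp add: algebra_simps)
  qed (use C t in auto)
  then show ?thesis by (simp add: y)
qed

text \<open>The step \<open>h\<close> is common to all initial times and all initial states in the
  ball, which is what makes continuation possible.\<close>

lemma autonomous_local_existence:
  assumes R: "0 \<le> R"
  obtains h where "0 < h"
    "\<And>a y0. norm y0 \<le> R \<Longrightarrow> \<exists>z. z a = y0 \<and> flow_curve a (a + h) (\<lambda>t. push_current \<xi>0 (z t)) z"
proof -
  \<comment> \<open>\<open>M\<close> bounds the field on the ball of radius R + 1, so a state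
    starting in the ball of radius R stays in the larger one for time 1/M.\<close>
  define M where "M = CB * (norm \<xi>0 * (2 + R) + 1) * (3 + R)"
  have M: "0 < M" unfolding M_def using CB_pos R by (simp add: add_nonneg_pos)
  have "\<exists>z. z a = y0 \<and> flow_curve a (a + 1 / M) (\<lambda>t. push_current \<xi>0 (z t)) z"
    if y0: "norm y0 \<le> R" for a :: real and y0
  proof -
    let ?b = "a + 1 / M" and ?\<rho> = "\<lambda>t. R + M * (t - a)"
    have \<rho>: "?\<rho> t \<le> R + 1" if "t \<in> {a..?b}" for t
    proof -
      have "M * (t - a) \<le> M * (1 / M)" using that M by (intro mult_left_mono) auto
      then show ?thesis using M by simp
    qed
    obtain z where "z a = y0"
      "\<And>t. t \<in> {a..?b} \<Longrightarrow> (z has_vector_derivative flow_field (push_current \<xi>0 (z t)) (z t)) (at t within {a..?b})"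
    proof (rule picard_lindelof[of "autonomous_lip \<xi>0 (R + 1)" a ?b ?\<rho> "\<lambda>_. M" y0
          "\<lambda>t x. flow_field (push_current \<xi>0 x) x"])
      show "0 < autonomous_lip \<xi>0 (R + 1)" using R by (intro autonomous_lip_pos) simp
      fix t assume t: "t \<in> {a..?b}"
      show "(?\<rho> has_vector_derivative M) (at t within {a..?b})"
        unfolding has_real_derivative_iff_has_vector_derivative[symmetric]
        by (auto intro!: derivative_eq_intros)
      fix x :: "'a flow_state" assume "norm x \<le> ?\<rho> t"
      then have x: "norm x \<le> R + 1" using \<rho>[OF t] by simp
      have "norm \<xi>0 * (1 + norm x) \<le> norm \<xi>0 * (2 + R)"
        using x by (intro mult_left_mono) auto
      then have "weak_norm (push_current \<xi>0 x) \<le> norm \<xi>0 * (2 + R)"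
        using weak_norm_push_current_le[of \<xi>0 x] by linarith
      then have "CB * (weak_norm (push_current \<xi>0 x) + 1) * (2 + norm x) \<le> M"
        unfolding M_def using x R CB_pos weak_norm_nonneg[of "push_current \<xi>0 x"]
        by (intro mult_mono mult_left_mono) auto
      then show "norm (flow_field (push_current \<xi>0 x) x) \<le> M"
        using norm_flow_field_le order_trans by blast
      fix w :: "'a flow_state" assume "norm w \<le> ?\<rho> t"
      then have "norm w \<le> R + 1" using \<rho>[OF t] by simp
      with x show "norm (flow_field (push_current \<xi>0 x) x - flow_field (push_current \<xi>0 w) w)
          \<le> autonomous_lip \<xi>0 (R + 1) * norm (x - w)"
        by (rule norm_autonomous_diff_le)
    next
      fix w :: "real \<Rightarrow> 'a flow_state" assume "continuous_on {a..?b} w"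
      then show "continuous_on {a..?b} (\<lambda>t. flow_field (push_current \<xi>0 (w t)) (w t))"
        by (intro continuous_on_flow_field weakly_continuous_on_push_current)
    qed (use y0 M in auto)
    then show ?thesis by (auto simp: flow_curve_def)
  qed
  with M show ?thesis by (intro that[of "1 / M"]) auto
qed

text \<open>At the joint the one-sided derivatives agree because the field depends on the state
  alone and the states coincide there.\<close>

lemma autonomous_concat:
  assumes y: "flow_curve a b (\<lambda>t. push_current \<xi>0 (y t)) y"
    and z: "flow_curve b c (\<lambda>t. push_current \<xi>0 (z t)) z"
    and eq: "y b = z b" and ab: "a \<le> b" "b \<le> c"
  defines "w \<equiv> \<lambda>t. if t \<in> {a..b} then y t else z t"
  shows "flow_curve a c (\<lambda>t. push_current \<xi>0 (w t)) w"
  unfolding flow_curve_def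
proof
  fix t assume t: "t \<in> {a..c}"
  have cl: "closure {a..b} \<inter> closure {b..c} = {b}" using ab by auto
  have "(w has_vector_derivative
      (if t \<in> {a..b} then flow_field (push_current \<xi>0 (y t)) (y t) else flow_field (push_current \<xi>0 (z t)) (z t)))
      (at t within {a..c})"
    unfolding w_def
  proof (rule has_vector_derivative_If_within_closures[where S = "{a..b}" and T = "{b..c}"
        and f' = "\<lambda>t. flow_field (push_current \<xi>0 (y t)) (y t)" and g' = "\<lambda>t. flow_field (push_current \<xi>0 (z t)) (z t)"])
    have "{a..b} \<union> {b} = {a..b}" "{b..c} \<union> {b} = {b..c}" using ab by auto
    then show "t \<in> {a..b} \<union> closure {a..b} \<inter> closure {b..c} \<Longrightarrow>
        (y has_vector_derivative flow_field (push_current \<xi>0 (y t)) (y t)) (at t within {a..b} \<union> closure {a..b} \<inter> closure {b..c})"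
      and "t \<in> {b..c} \<union> closure {a..b} \<inter> closure {b..c} \<Longrightarrow>
        (z has_vector_derivative flow_field (push_current \<xi>0 (z t)) (z t)) (at t within {b..c} \<union> closure {a..b} \<inter> closure {b..c})"
      unfolding cl using y z by (auto simp: flow_curve_def)
    show "t \<in> closure {a..b} \<Longrightarrow> t \<in> closure {b..c} \<Longrightarrow> y t = z t"
      and "t \<in> closure {a..b} \<Longrightarrow> t \<in> closure {b..c} \<Longrightarrow>
        flow_field (push_current \<xi>0 (y t)) (y t) = flow_field (push_current \<xi>0 (z t)) (z t)"
      using cl eq by (metis IntI singletonD)+
  qed (use t ab in auto)
  then show "(w has_vector_derivative flow_field (push_current \<xi>0 (w t)) (w t)) (at t within {a..c})"
    by (cases "t \<in> {a..b}") (simp_all only: w_def if_True if_False)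
qed

text \<open>Bounded currents keep all states before Tmax in one ball, so a single step length works
  from each time. The restart uses the state \<open>y T\<close> and keeps \<open>\<xi>0\<close>, so
  the pieces join to a solution of the original problem.\<close>

lemma solution_extends:
  assumes sol: "\<And>T. 0 < T \<Longrightarrow> T < Tmax \<Longrightarrow> is_solution B \<xi>0 T \<xi>" and Tmax: "0 < Tmax"
    and K: "0 \<le> K" "\<And>t. 0 \<le> t \<Longrightarrow> t < Tmax \<Longrightarrow> weak_norm (\<xi> t) \<le> K"
  shows "\<exists>T>Tmax. unique_solution_on B \<xi>0 T"
proof -
  let ?C = "CB * (K + 1)"
  define R where "R = 2 * ?C * Tmax * exp (?C * Tmax)"
  have C: "0 \<le> ?C" using K CB_pos by simp
  have R0: "0 \<le> R" using C Tmax by (simp add: R_def)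
  obtain h where h: "0 < h"
    "\<And>a y0. norm y0 \<le> R \<Longrightarrow> \<exists>z. z a = y0 \<and> flow_curve a (a + h) (\<lambda>t. push_current \<xi>0 (z t)) z"
    using autonomous_local_existence[OF R0, of \<xi>0] by blast
  \<comment> \<open>Within h/2 of Tmax, so that one step overshoots it; the alternative Tmax / 2
    keeps \<open>T\<close> positive when h is large.\<close>
  define T where "T = max (Tmax - h / 2) (Tmax / 2)"
  have T: "0 < T" "T < Tmax" "Tmax < T + h" using Tmax h(1) by (auto simp: T_def max_def)
  obtain y where y: "y 0 = 0" "flow_curve 0 T \<xi> y" "\<And>t. t \<in> {0..T} \<Longrightarrow> \<xi> t = push_current \<xi>0 (y t)"
    using is_solution_flow_curve[OF sol[OF T(1,2)] less_imp_le[OF T(1)]] by blast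
  have "norm (y T) \<le> 2 * ?C * T * exp (?C * T)"
    using T K by (intro flow_curve_bounded[OF y(2,1)]) auto
  also have "\<dots> \<le> R"
    unfolding R_def using T C CB_pos K(1) by (intro mult_mono) (auto intro!: mult_left_mono)
  finally obtain z where z: "z T = y T" "flow_curve T (T + h) (\<lambda>t. push_current \<xi>0 (z t)) z"
    using h(2) by blast
  have y': "flow_curve 0 T (\<lambda>t. push_current \<xi>0 (y t)) y"
    using y(2) flow_curve_cong[of 0 T \<xi>, OF y(3)] by blast
  let ?w = "\<lambda>t. if t \<in> {0..T} then y t else z t"
  have "flow_curve 0 (T + h) (\<lambda>t. push_current \<xi>0 (?w t)) ?w"
    using autonomous_concat[OF y' z(2)] z(1) T h(1) by simp
  then have "is_solution B \<xi>0 (T + h) (\<lambda>t. push_current \<xi>0 (?w t))"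
    by (rule flow_curve_is_solution[rotated]) (use y T in auto)
  then show ?thesis using unique_solution_onI T(3) by blast
qed

text \<open>Failure of divergence supplies times arbitrarily close to Tmax with weak norm below a
  fixed level. One of them, close enough for the short-time bound to reach Tmax, controls all later
  times; compactness controls the earlier ones.\<close>

lemma weak_norm_bounded_if_not_blow_up:
  assumes sol: "\<And>T. 0 < T \<Longrightarrow> T < Tmax \<Longrightarrow> is_solution B \<xi>0 T \<xi>" and Tmax: "0 < Tmax"
    and not: "\<not> filterlim (\<lambda>t. weak_norm (\<xi> t)) at_top (at_left Tmax)"
  obtains K where "0 \<le> K" "\<And>t. 0 \<le> t \<Longrightarrow> t < Tmax \<Longrightarrow> weak_norm (\<xi> t) \<le> K"
proof -
  obtain Z where Z: "\<not> eventually (\<lambda>t. Z \<le> weak_norm (\<xi> t)) (at_left Tmax)"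
    using not by (auto simp: filterlim_at_top)
  define K where "K = max 0 Z"
  have K0: "0 \<le> K" by (simp add: K_def)
  \<comment> \<open>Exactly the time span that the smallness condition of
    \<open>weak_norm_short_time_bound\<close> allows for level \<open>K\<close>.\<close>
  define \<eta> where "\<eta> = 1 / (8 * (CB * (2 * K + 2)))"
  have CK: "0 < CB * (2 * K + 2)" using CB_pos K0 by simp
  have \<eta>: "0 < \<eta>" using CK by (simp add: \<eta>_def)
  have "max 0 (Tmax - \<eta>) < Tmax" using Tmax \<eta> by simp
  with Z obtain s where s: "max 0 (Tmax - \<eta>) < s" "s < Tmax" "weak_norm (\<xi> s) < Z"
    unfolding eventually_at_left_field by (meson not_le)
  have late: "weak_norm (\<xi> t) \<le> 2 * K + 1" if t: "s \<le> t" "t < Tmax" for t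
  proof -
    have t0: "0 < t" using s t by simp
    obtain y where y: "flow_curve 0 t \<xi> y" "\<And>r. r \<in> {0..t} \<Longrightarrow> \<xi> r = push_current \<xi>0 (y r)"
      using is_solution_flow_curve[OF sol[OF t0 t(2)] less_imp_le[OF t0]] by blast
    have "CB * (2 * K + 2) * (t - s) \<le> CB * (2 * K + 2) * \<eta>"
      using CK s t by (intro mult_left_mono) auto
    also have "\<dots> = 1 / 8"
    proof -
      have "u * (1 / (8 * u)) = 1 / 8" if "0 < u" for u :: real using that by simp
      from this[OF CK] show ?thesis by (simp only: \<eta>_def)
    qed
    finally show ?thesis
      using s t t0 by (intro weak_norm_short_time_bound[OF y]) (auto simp: K_def)
  qed
  have "0 < s" using s by simp
  obtain K' where K': "0 \<le> K'" "\<And>t. t \<in> {0..s} \<Longrightarrow> weak_norm (\<xi> t) \<le> K'"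
    using weakly_continuous_on_bounded[OF is_solution_weakly_continuous[OF sol[OF \<open>0 < s\<close> s(2)]]] by blast
  show ?thesis
  proof (rule that[of "max K' (2 * K + 1)"])
    show "weak_norm (\<xi> t) \<le> max K' (2 * K + 1)" if "0 \<le> t" "t < Tmax" for t
      using K'(2)[of t] late[of t] that by (cases "t \<le> s") (auto simp: le_max_iff_disj)
  qed (use K' in auto)
qed

end

text \<open>Finiteness of the maximal time is expressed by \<open>bdd_above\<close>; together with
  nonemptiness it makes the real supremum the intended one.\<close>

theorem theorem3p6:
  fixes B :: "'a::euclidean_space current \<Rightarrow> 'a \<Rightarrow> 'a"
    and DB :: "'a current \<Rightarrow> 'a \<Rightarrow> ('a \<Rightarrow>\<^sub>L 'a)"
    and D2B :: "'a current \<Rightarrow> 'a \<Rightarrow> ('a \<Rightarrow>\<^sub>L 'a \<Rightarrow>\<^sub>L 'a)"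
    and CB :: real and \<xi>0 :: "'a current" and \<xi> :: "real \<Rightarrow> 'a current" and Tmax :: real
  assumes "standing_assms B DB D2B CB"
    and "{T. T > 0 \<and> unique_solution_on B \<xi>0 T} \<noteq> {}"
    and "Tmax = Sup {T. T > 0 \<and> unique_solution_on B \<xi>0 T}"
    and "\<forall>T. 0 < T \<and> T < Tmax \<longrightarrow> is_solution B \<xi>0 T \<xi>"
    and "bdd_above {T. T > 0 \<and> unique_solution_on B \<xi>0 T}"
  shows "filterlim (\<lambda>t. weak_norm (\<xi> t)) at_top (at_left Tmax)"
proof (rule ccontr)
  assume not: "\<not> ?thesis"
  interpret current_transport B DB D2B CB using assms(1) by unfold_locales
  let ?E = "{T. T > 0 \<and> unique_solution_on B \<xi>0 T}"
  have upper: "T \<le> Tmax" if "T \<in> ?E" for T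
    unfolding assms(3) using that assms(5) by (rule cSup_upper)
  with assms(2) have Tmax: "0 < Tmax" by force
  have sol: "is_solution B \<xi>0 T \<xi>" if "0 < T" "T < Tmax" for T
    using assms(4) that by blast
  obtain K where "0 \<le> K" "\<And>t. 0 \<le> t \<Longrightarrow> t < Tmax \<Longrightarrow> weak_norm (\<xi> t) \<le> K"
    using weak_norm_bounded_if_not_blow_up[OF sol Tmax not] by blast
  from solution_extends[OF sol Tmax this] obtain T where "Tmax < T" "unique_solution_on B \<xi>0 T" by blast
  with upper[of T] Tmax show False by simp
qed

end
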